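(* Let $\mathcal{P}$ be a simple (weakly connected) collection of cells with connected components $\mathcal{P}_1,\dots,\mathcal{P}_n$, and $K$ a field. If $h_{K[\mathcal{P}_i]}(t)$ denotes the $h$-polynomial of $K[\mathcal{P}_i]$, then $\prod_{i=1}^n h_{K[\mathcal{P}_i]}(t)$ is the $h$-polynomial of $K[\mathcal{P}]$.
   Context: Intervals: for $a\le b$ in $\mathbb{Z}^2$ (componentwise) $[a,b]$ is the set of lattice points between them, proper if both coordinates are strictly smaller; diagonal corners $a,b$, anti-diagonal corners $(a_1,b_2),(b_1,a_2)$. A cell is $[a,a+(1,1)]$. A collection of cells is a finite non-empty set of cells which is weakly connected (any two cells joined by a sequence of its cells with consecutive ones sharing a vertex). A polyomino is a collection in which any two cells are joined by a sequence of cells of it, consecutive ones sharing an edge; a connected component is a maximal sub-polyomino. $\mathcal{P}$ is simple if any two cells of $\mathbb{Z}^2$ not in $\mathcal{P}$ are joined by such an edge-sharing sequence of cells not in $\mathcal{P}$. An inner interval of $\mathcal{P}$ is a proper interval all of whose cells lie in $\mathcal{P}$; its inner 2-minor is $x_ax_b-x_cx_d$. $K[\mathcal{P}]=S_{\mathcal{P}}/I_{\mathcal{P}}$ where $S_{\mathcal{P}}=K[x_v:v\in V(\mathcal{P})]$ (standard grading) and $I_{\mathcal{P}}$ is generated by the inner 2-minors. The $h$-polynomial of a standard graded algebra $R$ of Krull dimension $d$ is the polynomial $h(t)$ with $h(1)\ne 0$ such that the Hilbert–Poincaré series is $h(t)/(1-t)^d$. *)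

theory Defs
  imports "HOL-Library.Poly_Mapping" "HOL-Computational_Algebra.Computational_Algebra"
begin

type_synonym pt = "int \<times> int"

definition lat_interval :: "pt \<Rightarrow> pt \<Rightarrow> pt set" where
  "lat_interval a b = {p. fst a \<le> fst p \<and> fst p \<le> fst b \<and> snd a \<le> snd p \<and> snd p \<le> snd b}"

definition is_cell :: "pt set \<Rightarrow> bool" where
  "is_cell C \<longleftrightarrow> (\<exists>a. C = lat_interval a (fst a + 1, snd a + 1))"

definition share_vertex :: "pt set \<Rightarrow> pt set \<Rightarrow> bool" where
  "share_vertex C D \<longleftrightarrow> C \<inter> D \<noteq> {}"

definition share_edge :: "pt set \<Rightarrow> pt set \<Rightarrow> bool" where
  "share_edge C D \<longleftrightarrow> card (C \<inter> D) \<ge> 2"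

definition weakly_connected :: "pt set set \<Rightarrow> bool" where
  "weakly_connected P \<longleftrightarrow>
     (\<forall>C\<in>P. \<forall>D\<in>P. (\<lambda>X Y. X \<in> P \<and> Y \<in> P \<and> share_vertex X Y)\<^sup>*\<^sup>* C D)"

definition edge_connected :: "pt set set \<Rightarrow> bool" where
  "edge_connected P \<longleftrightarrow>
     (\<forall>C\<in>P. \<forall>D\<in>P. (\<lambda>X Y. X \<in> P \<and> Y \<in> P \<and> share_edge X Y)\<^sup>*\<^sup>* C D)"

definition collection_of_cells :: "pt set set \<Rightarrow> bool" where
  "collection_of_cells P \<longleftrightarrow> finite P \<and> P \<noteq> {} \<and> (\<forall>C\<in>P. is_cell C) \<and> weakly_connected P"

definition polyomino :: "pt set set \<Rightarrow> bool" where
  "polyomino P \<longleftrightarrow> collection_of_cells P \<and> edge_connected P"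

definition components :: "pt set set \<Rightarrow> pt set set set" where
  "components P = {Q. Q \<subseteq> P \<and> polyomino Q \<and>
      (\<forall>Q'. Q \<subseteq> Q' \<and> Q' \<subseteq> P \<and> polyomino Q' \<longrightarrow> Q' = Q)}"

definition simple :: "pt set set \<Rightarrow> bool" where
  "simple P \<longleftrightarrow> (\<forall>C D. is_cell C \<and> is_cell D \<and> C \<notin> P \<and> D \<notin> P \<longrightarrow>
     (\<lambda>X Y. is_cell X \<and> is_cell Y \<and> X \<notin> P \<and> Y \<notin> P \<and> share_edge X Y)\<^sup>*\<^sup>* C D)"

definition vertices :: "pt set set \<Rightarrow> pt set" where
  "vertices P = \<Union>P"

definition inner_interval :: "pt set set \<Rightarrow> pt \<Rightarrow> pt \<Rightarrow> bool" where
  "inner_interval P a b \<longleftrightarrow> fst a < fst b \<and> snd a < snd b \<and>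
     (\<forall>C. is_cell C \<and> C \<subseteq> lat_interval a b \<longrightarrow> C \<in> P)"

type_synonym 'k mpoly = "((pt \<Rightarrow>\<^sub>0 nat) \<Rightarrow>\<^sub>0 'k)"

definition var :: "pt \<Rightarrow> 'k::comm_ring_1 mpoly" where
  "var v = Poly_Mapping.single (Poly_Mapping.single v 1) 1"

definition smult_mp :: "'k::comm_ring_1 \<Rightarrow> 'k mpoly \<Rightarrow> 'k mpoly" where
  "smult_mp c f = Poly_Mapping.single 0 c * f"

definition mdeg :: "(pt \<Rightarrow>\<^sub>0 nat) \<Rightarrow> nat" where
  "mdeg m = (\<Sum>v\<in>Poly_Mapping.keys m. Poly_Mapping.lookup m v)"

definition poly_ring :: "pt set \<Rightarrow> 'k::comm_ring_1 mpoly set" where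
  "poly_ring V = {f. \<forall>m\<in>Poly_Mapping.keys f. Poly_Mapping.keys m \<subseteq> V}"

definition homog :: "nat \<Rightarrow> 'k::comm_ring_1 mpoly set" where
  "homog k = {f. \<forall>m\<in>Poly_Mapping.keys f. mdeg m = k}"

definition inner_minors :: "pt set set \<Rightarrow> 'k::comm_ring_1 mpoly set" where
  "inner_minors P = {var a * var b - var (fst a, snd b) * var (fst b, snd a) | a b.
                      inner_interval P a b}"

definition ideal_gen :: "'k::comm_ring_1 mpoly set \<Rightarrow> 'k mpoly set \<Rightarrow> 'k mpoly set" where
  "ideal_gen R G = {(\<Sum>g\<in>F. q g * g) | F q. finite F \<and> F \<subseteq> G \<and> (\<forall>g\<in>F. q g \<in> R)}"

definition polyomino_ideal :: "pt set set \<Rightarrow> 'k::comm_ring_1 mpoly set" where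
  "polyomino_ideal P = ideal_gen (poly_ring (vertices P)) (inner_minors P)"

definition lin_indep :: "'k::field mpoly set \<Rightarrow> bool" where
  "lin_indep F \<longleftrightarrow> finite F \<and>
     (\<forall>c. (\<Sum>x\<in>F. smult_mp (c x) x) = 0 \<longrightarrow> (\<forall>x\<in>F. c x = 0))"

definition vdim :: "'k::field mpoly set \<Rightarrow> nat" where
  "vdim A = Max {card F | F. F \<subseteq> A \<and> lin_indep F}"

text \<open>Hilbert function of K[P] = S_P / I_P:  dim_K (S_P)_k - dim_K (I_P)_k\<close>
definition hilbert_fun :: "'k::field itself \<Rightarrow> pt set set \<Rightarrow> nat \<Rightarrow> nat" where
  "hilbert_fun K P k =
     vdim (poly_ring (vertices P) \<inter> homog k :: 'k mpoly set)
   - vdim (polyomino_ideal P \<inter> homog k :: 'k mpoly set)"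

definition hilbert_series :: "'k::field itself \<Rightarrow> pt set set \<Rightarrow> int fps" where
  "hilbert_series K P = Abs_fps (\<lambda>k. int (hilbert_fun K P k))"

definition is_h_polynomial :: "'k::field itself \<Rightarrow> pt set set \<Rightarrow> int poly \<Rightarrow> bool" where
  "is_h_polynomial K P h \<longleftrightarrow> poly h 1 \<noteq> 0 \<and>
     (\<exists>d::nat. hilbert_series K P * (1 - fps_X) ^ d = fps_of_poly h)"

end

theory Submission
  imports Defs "HOL-Library.Multiset"
begin

text \<open>
  The inner 2-minors are differences of monomials, so \<open>K[P]\<close> is the algebra of the monoid of
  monomials modulo the congruence \<open>x\<^sub>a x\<^sub>b \<sim> x\<^sub>c x\<^sub>d\<close>, and its Hilbert function counts congruence
  classes.

  For simple \<open>P\<close> this monoid is cancellative. Assign to each vertex the maximal horizontal and the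
  maximal vertical segment of edges of \<open>P\<close> through it; this turns monomials into multisets of edges
  of a bipartite graph. Two monomials with the same degrees at all segments differ by alternating
  cycles, and a cycle of length at least six has a chord, because the region it encloses contains
  no empty cell. Cutting along chords reduces every cycle to rectangles, that is, to inner
  intervals. Hence congruence is equality of degrees, which can be cancelled.

  The same parity argument shows that a connected union of components and a further component share
  at most one vertex \<open>v\<close>. Gluing along \<open>v\<close> identifies two variables; since \<open>x\<^sub>v\<close> is cancellable, the
  Hilbert series get multiplied together with a factor \<open>1 - t\<close>. Adding the components one by one
  yields the product formula, the factors \<open>1 - t\<close> being absorbed by the Krull dimensions.
\<close>

section \<open>Congruences of monomials and the Hilbert function\<close>

text \<open>Two points need more than the outline says. Cycles of segments may cross or overlap
  themselves, so their interior is not that of a Jordan curve. The substitute is the parity with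
  which a closed walk crosses the vertical ray above a cell. It is the same at edge-adjacent empty
  cells and zero at cells above the walk; simplicity joins every empty cell to such a high one, so
  the parity is even at every empty cell. This single fact gives the chords, the filled rectangles
  and the uniqueness of shared vertices. The factor \<open>1 - t\<close> comes from freeness. If the
  variable of \<open>v\<close> cancels in the monoid of a component, every class is uniquely a power
  of that variable times a class not divisible by it. So the algebra is free over the polynomials in
  that variable, the reduced classes are a basis, and their series is the Hilbert series times
  \<open>1 - t\<close>. Gluing along \<open>v\<close> is a tensor product over these polynomials. It
  is treated asymmetrically: freeness is used for the added component only, while the union built so
  far enters through its class count.\<close>

definition bstep :: "('a multiset \<times> 'a multiset) set \<Rightarrow> 'a multiset \<Rightarrow> 'a multiset \<Rightarrow> bool" where
  "bstep R M N \<longleftrightarrow> (\<exists>U x y. ((x, y) \<in> R \<or> (y, x) \<in> R) \<and> M = U + x \<and> N = U + y)"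

abbreviation bcong :: "('a multiset \<times> 'a multiset) set \<Rightarrow> 'a multiset \<Rightarrow> 'a multiset \<Rightarrow> bool" where
  "bcong R \<equiv> (bstep R)\<^sup>*\<^sup>*"

definition graded_on :: "'a set \<Rightarrow> ('a multiset \<times> 'a multiset) set \<Rightarrow> bool" where
  "graded_on V R \<longleftrightarrow>
     (\<forall>(x, y)\<in>R. set_mset x \<subseteq> V \<and> set_mset y \<subseteq> V \<and> size x = size y)"

definition monoms :: "'a set \<Rightarrow> nat \<Rightarrow> 'a multiset set" where
  "monoms V k = {M. set_mset M \<subseteq> V \<and> size M = k}"

text \<open>Congruent multisets yield the same predicate \<open>bcong R M\<close>, and
  \<open>SOME\<close> depends on that predicate alone, so the choice is constant on each
  class.\<close>

definition brep :: "('a multiset \<times> 'a multiset) set \<Rightarrow> 'a multiset \<Rightarrow> 'a multiset" where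
  "brep R M = (SOME N. bcong R M N)"

definition class_count :: "'a set \<Rightarrow> ('a multiset \<times> 'a multiset) set \<Rightarrow> nat \<Rightarrow> nat" where
  "class_count V R k = card (brep R ` monoms V k)"

lemma bstep_sym: "bstep R M N \<Longrightarrow> bstep R N M"
  unfolding bstep_def by blast

lemma bcong_sym: "bcong R M N \<Longrightarrow> bcong R N M"
  by (metis bstep_sym sympD sympI symp_rtranclp)

lemma bstep_add: "bstep R M N \<Longrightarrow> bstep R (U + M) (U + N)"
  unfolding bstep_def by (metis add.assoc)

lemma bcong_add: "bcong R M N \<Longrightarrow> bcong R (U + M) (U + N)"
  by (induction rule: rtranclp_induct) (auto intro: bstep_add rtranclp.rtrancl_into_rtrancl)

lemma bcong_add2:
  assumes "bcong R M N" "bcong R M' N'"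
  shows "bcong R (M + M') (N + N')"
  using bcong_add[OF assms(1), of M'] bcong_add[OF assms(2), of N]
  by (simp add: add.commute)

lemma bcong_rel: "(x, y) \<in> R \<Longrightarrow> bcong R x y"
  by (rule r_into_rtranclp, unfold bstep_def) (metis add_0)

lemma bstep_mono: "R \<subseteq> S \<Longrightarrow> bstep R M N \<Longrightarrow> bstep S M N"
  unfolding bstep_def by blast

lemma bcong_mono: "R \<subseteq> S \<Longrightarrow> bcong R M N \<Longrightarrow> bcong S M N"
  by (metis bstep_mono mono_rtranclp)

lemma bcong_graded:
  assumes "graded_on V R" "bcong R M N"
  shows "size N = size M \<and> (set_mset M \<subseteq> V \<longleftrightarrow> set_mset N \<subseteq> V)"
  using assms(2)
proof (induction rule: rtranclp_induct)
  case (step N N')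
  then show ?case using assms(1) unfolding bstep_def graded_on_def by fastforce
qed simp

lemma bcong_monoms:
  "graded_on V R \<Longrightarrow> bcong R M N \<Longrightarrow> M \<in> monoms V k \<longleftrightarrow> N \<in> monoms V k"
  using bcong_graded[of V R M N] unfolding monoms_def by auto

lemma bcong_brep: "bcong R M (brep R M)"
  unfolding brep_def by (rule someI[of _ M]) simp

lemma brep_eq_iff: "brep R M = brep R N \<longleftrightarrow> bcong R M N"
proof
  assume "brep R M = brep R N"
  then show "bcong R M N" using bcong_brep bcong_sym rtranclp_trans by metis
next
  assume "bcong R M N"
  then have "bcong R M = bcong R N" by (intro ext) (meson bcong_sym rtranclp_trans)
  then show "brep R M = brep R N" unfolding brep_def by simp
qed

lemma brep_idem [simp]: "brep R (brep R M) = brep R M"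
  by (metis bcong_brep brep_eq_iff)

lemma brep_monoms: "graded_on V R \<Longrightarrow> M \<in> monoms V k \<Longrightarrow> brep R M \<in> monoms V k"
  using bcong_monoms bcong_brep by metis

lemma finite_monoms:
  assumes "finite V"
  shows "finite (monoms V k)"
proof -
  have "monoms V k \<subseteq> mset ` {xs. set xs \<subseteq> V \<and> length xs = k}"
  proof
    fix M assume M: "M \<in> monoms V k"
    obtain xs where "mset xs = M" using ex_mset by blast
    then show "M \<in> mset ` {xs. set xs \<subseteq> V \<and> length xs = k}"
      using M unfolding monoms_def by (auto intro!: image_eqI[of _ _ xs])
  qed
  then show ?thesis using finite_lists_length_eq[OF assms] finite_surj by blast
qed

text \<open>Any complete invariant can replace the chosen representatives in the count; applied
  below to the normal form of a glued monoid.\<close>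

lemma class_count_eq_card_image:
  assumes "\<And>M N. M \<in> monoms V k \<Longrightarrow> N \<in> monoms V k \<Longrightarrow> f M = f N \<longleftrightarrow> bcong R M N"
  shows "class_count V R k = card (f ` monoms V k)"
proof -
  have "bij_betw (\<lambda>c. brep R (inv_into (monoms V k) f c)) (f ` monoms V k) (brep R ` monoms V k)"
  proof (rule bij_betw_imageI)
    show "inj_on (\<lambda>c. brep R (inv_into (monoms V k) f c)) (f ` monoms V k)"
      by (rule inj_onI) (metis assms brep_eq_iff f_inv_into_f inv_into_into)
    have "brep R (inv_into (monoms V k) f (f M)) = brep R M" if "M \<in> monoms V k" for M
      using that by (metis assms brep_eq_iff f_inv_into_f image_eqI inv_into_into)
    then show "(\<lambda>c. brep R (inv_into (monoms V k) f c)) ` f ` monoms V k = brep R ` monoms V k"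
      by (auto simp: image_image)
  qed
  then show ?thesis unfolding class_count_def by (metis bij_betw_same_card)
qed

lemma class_count_pos:
  assumes "finite V" "v \<in> V"
  shows "class_count V R k > 0"
proof -
  have "replicate_mset k v \<in> monoms V k" using assms(2) unfolding monoms_def by auto
  then show ?thesis unfolding class_count_def
    using finite_monoms[OF assms(1), of k] by (auto simp: card_gt_0_iff)
qed

text \<open>The monomials that are not representatives will index a basis of the ideal in degree
  \<open>k\<close>.\<close>

lemma card_non_representatives:
  assumes "finite V" "graded_on V R"
  shows "card {M \<in> monoms V k. brep R M \<noteq> M} = card (monoms V k) - class_count V R k"
    and "class_count V R k \<le> card (monoms V k)"
proof -
  have *: "brep R ` monoms V k = {M \<in> monoms V k. brep R M = M}"
  proof -
    have "brep R ` monoms V k \<subseteq> {M \<in> monoms V k. brep R M = M}"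
      using brep_monoms[OF assms(2)] by auto
    moreover have "{M \<in> monoms V k. brep R M = M} \<subseteq> brep R ` monoms V k"
      by (auto intro!: rev_image_eqI)
    ultimately show ?thesis by blast
  qed
  show "class_count V R k \<le> card (monoms V k)"
    unfolding class_count_def using card_image_le finite_monoms assms by blast
  have "{M \<in> monoms V k. brep R M \<noteq> M} = monoms V k - {M \<in> monoms V k. brep R M = M}" by auto
  then show "card {M \<in> monoms V k. brep R M \<noteq> M} = card (monoms V k) - class_count V R k"
    unfolding class_count_def * using finite_monoms[OF assms(1), of k]
    by (simp add: card_Diff_subset)
qed

section \<open>Multisets as exponent vectors\<close>

definition mon :: "pt multiset \<Rightarrow> (pt \<Rightarrow>\<^sub>0 nat)" where
  "mon M = Abs_poly_mapping (count M)"

definition nom :: "(pt \<Rightarrow>\<^sub>0 nat) \<Rightarrow> pt multiset" where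
  "nom m = Abs_multiset (Poly_Mapping.lookup m)"

lemma lookup_mon [simp]: "Poly_Mapping.lookup (mon M) = count M"
  unfolding mon_def by (rule Abs_poly_mapping_inverse) (use count[of M] in auto)

lemma count_nom [simp]: "count (nom m) = Poly_Mapping.lookup m"
  unfolding nom_def
  by (rule count_Abs_multiset) (use lookup[of m] in auto)

lemma nom_mon [simp]: "nom (mon M) = M"
  by (rule multiset_eqI) simp

lemma mon_nom [simp]: "mon (nom m) = m"
  by (rule poly_mapping_eqI) simp

lemma mon_inj [simp]: "mon M = mon N \<longleftrightarrow> M = N"
  by (metis nom_mon)

lemma mon_add: "mon (M + N) = mon M + mon N"
  by (rule poly_mapping_eqI) (simp add: lookup_add)

lemma nom_add: "nom (m + n) = nom m + nom n"
  by (metis mon_add mon_nom nom_mon)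

lemma mon_single: "mon {#v#} = Poly_Mapping.single v 1"
  by (rule poly_mapping_eqI) (auto simp: lookup_single when_def)

lemma keys_mon [simp]: "Poly_Mapping.keys (mon M) = set_mset M"
  by (auto simp: in_keys_iff count_greater_zero_iff[symmetric] simp del: count_greater_zero_iff)

lemma mdeg_mon [simp]: "mdeg (mon M) = size M"
  unfolding mdeg_def by (simp add: size_multiset_overloaded_eq)

lemma set_mset_nom [simp]: "set_mset (nom m) = Poly_Mapping.keys m"
  by (metis keys_mon mon_nom)

lemma size_nom [simp]: "size (nom m) = mdeg m"
  by (metis mdeg_mon mon_nom)

abbreviation pmono :: "pt multiset \<Rightarrow> 'k::comm_ring_1 mpoly" where
  "pmono M \<equiv> Poly_Mapping.single (mon M) 1"

lemma pmono_add: "pmono (M + N) = pmono M * pmono N"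
  by (simp add: mult_single mon_add)

lemma pmono_in_poly_ring: "set_mset M \<subseteq> V \<Longrightarrow> pmono M \<in> poly_ring V"
  unfolding poly_ring_def by simp

lemma var_eq_pmono: "var v = pmono {#v#}"
  unfolding var_def mon_single ..

lemma poly_ring_homog_keys:
  assumes "f \<in> poly_ring V \<inter> homog k" "m \<in> Poly_Mapping.keys f"
  shows "nom m \<in> monoms V k"
  using assms unfolding poly_ring_def homog_def monoms_def by auto

lemma diff_in_poly_ring: "f \<in> poly_ring V \<Longrightarrow> g \<in> poly_ring V \<Longrightarrow> f - g \<in> poly_ring V"
  unfolding poly_ring_def using keys_diff[of f g] by blast

lemma add_in_poly_ring: "f \<in> poly_ring V \<Longrightarrow> g \<in> poly_ring V \<Longrightarrow> f + g \<in> poly_ring V"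
  unfolding poly_ring_def using keys_add[of f g] by blast

lemma mult_in_poly_ring:
  assumes "f \<in> poly_ring V" "g \<in> poly_ring V"
  shows "f * g \<in> poly_ring V"
  unfolding poly_ring_def
proof (clarify)
  fix m a b assume m: "m \<in> Poly_Mapping.keys (f * g)" and ab: "(a, b) \<in> Poly_Mapping.keys m"
  obtain m1 m2 where "m = m1 + m2" "m1 \<in> Poly_Mapping.keys f" "m2 \<in> Poly_Mapping.keys g"
    using keys_mult[of f g] m by blast
  then show "(a, b) \<in> V"
    using assms keys_add[of m1 m2] ab unfolding poly_ring_def by blast
qed

lemma diff_homog: "f \<in> homog k \<Longrightarrow> g \<in> homog k \<Longrightarrow> f - g \<in> homog k"
  unfolding homog_def using keys_diff[of f g] by blast

lemma poly_mapping_expand: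
  assumes "finite S" "Poly_Mapping.keys f \<subseteq> S"
  shows "f = (\<Sum>m\<in>S. Poly_Mapping.single m (Poly_Mapping.lookup f m))"
proof (rule poly_mapping_eqI)
  fix n
  have "(\<Sum>m\<in>S. Poly_Mapping.lookup (Poly_Mapping.single m (Poly_Mapping.lookup f m)) n)
      = (\<Sum>m\<in>S. if m = n then Poly_Mapping.lookup f m else 0)"
    by (rule sum.cong) (auto simp: lookup_single when_def)
  also have "\<dots> = Poly_Mapping.lookup f n"
    using assms by (auto simp: in_keys_iff)
  finally show "Poly_Mapping.lookup f n =
    Poly_Mapping.lookup (\<Sum>m\<in>S. Poly_Mapping.single m (Poly_Mapping.lookup f m)) n"
    by (simp add: lookup_sum)
qed

section \<open>Linear algebra over the monomials\<close>

lemma lookup_smult_mp [simp]: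
  "Poly_Mapping.lookup (smult_mp c f) m = c * Poly_Mapping.lookup f m"
proof -
  have "smult_mp c f = Poly_Mapping.map ((*) c) f"
    unfolding smult_mp_def by (simp add: mult_map_scale_conv_mult)
  then show ?thesis by (simp add: map.rep_eq when_def)
qed

lemma smult_mp_single: "smult_mp c (Poly_Mapping.single m d) = Poly_Mapping.single m (c * d)"
  by (rule poly_mapping_eqI) (simp add: lookup_single when_def)

interpretation mp: vector_space "smult_mp :: 'k::field \<Rightarrow> 'k mpoly \<Rightarrow> 'k mpoly"
  by unfold_locales (auto intro!: poly_mapping_eqI simp: lookup_add algebra_simps)

lemma lin_indep_iff: "lin_indep F \<longleftrightarrow> finite F \<and> \<not> mp.dependent F"
  unfolding lin_indep_def using mp.dependent_finite[of F] by blast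

text \<open>The exchange bound caps every independent subset of \<open>A\<close> by
  \<open>card B\<close>, so the maximum defining \<open>vdim\<close> exists, and \<open>B\<close>
  attains it.\<close>

lemma vdim_eq_card:
  assumes "finite B" "B \<subseteq> A" "\<not> mp.dependent B" "A \<subseteq> mp.span B"
  shows "vdim A = card B"
  unfolding vdim_def
proof (rule Max_eqI)
  have le: "card F \<le> card B" if "F \<subseteq> A" "lin_indep F" for F
    using mp.independent_span_bound[OF assms(1), of F] that assms(4) by (auto simp: lin_indep_iff)
  then show "\<And>n. n \<in> {card F |F. F \<subseteq> A \<and> lin_indep F} \<Longrightarrow> n \<le> card B" by auto
  then show "finite {card F |F. F \<subseteq> A \<and> lin_indep F}"
    by (meson finite_nat_set_iff_bounded_le)
  show "card B \<in> {card F |F. F \<subseteq> A \<and> lin_indep F}" using assms by (auto simp: lin_indep_iff)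
qed

text \<open>The coefficients at the monomials of \<open>S\<close> act as dual functionals: on the
  family \<open>b\<close> they form an identity matrix.\<close>

lemma independent_imageI:
  assumes "finite S" "\<And>M N. M \<in> S \<Longrightarrow> N \<in> S \<Longrightarrow>
    Poly_Mapping.lookup (b M) (mon N) = (if M = N then 1 else 0 :: 'k::field)"
  shows "inj_on b S" "\<not> mp.dependent (b ` S)"
proof -
  show inj: "inj_on b S"
    by (rule inj_onI) (metis assms(2) zero_neq_one)
  show "\<not> mp.dependent (b ` S)"
  proof (rule mp.independent_if_scalars_zero)
    show "finite (b ` S)" using assms(1) by simp
    fix f x assume sum0: "(\<Sum>x\<in>b ` S. smult_mp (f x) x) = 0" and "x \<in> b ` S"
    then obtain N where N: "N \<in> S" "x = b N" by auto
    have "0 = Poly_Mapping.lookup (\<Sum>x\<in>b ` S. smult_mp (f x) x) (mon N)" by (simp add: sum0)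
    also have "\<dots> = (\<Sum>M\<in>S. f (b M) * Poly_Mapping.lookup (b M) (mon N))"
      by (simp add: lookup_sum sum.reindex[OF inj])
    also have "\<dots> = (\<Sum>M\<in>S. if M = N then f (b M) else 0)"
      by (rule sum.cong) (auto simp: assms(2) N)
    also have "\<dots> = f x" using assms(1) N by simp
    finally show "f x = 0" by simp
  qed
qed

lemma vdim_poly_ring:
  assumes "finite V"
  shows "vdim (poly_ring V \<inter> homog k :: 'k::field mpoly set) = card (monoms V k)"
proof -
  let ?S = "monoms V k"
  let ?b = "pmono :: pt multiset \<Rightarrow> 'k mpoly"
  have fin: "finite ?S" using assms by (rule finite_monoms)
  have lk: "Poly_Mapping.lookup (?b M) (mon N) = (if M = N then 1 else 0)" for M N
    by (simp add: lookup_single when_def)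
  have inj: "inj_on ?b ?S" and indep: "\<not> mp.dependent (?b ` ?S)"
    using independent_imageI[OF fin, of ?b] lk by blast+
  have "vdim (poly_ring V \<inter> homog k :: 'k mpoly set) = card (?b ` ?S)"
  proof (rule vdim_eq_card[OF _ _ indep])
    show "finite (?b ` ?S)" using fin by simp
    show "?b ` ?S \<subseteq> poly_ring V \<inter> homog k"
      unfolding monoms_def by (auto simp: pmono_in_poly_ring homog_def)
    show "poly_ring V \<inter> homog k \<subseteq> mp.span (?b ` ?S)"
    proof
      fix f :: "'k mpoly" assume f: "f \<in> poly_ring V \<inter> homog k"
      have "f = (\<Sum>m\<in>Poly_Mapping.keys f. Poly_Mapping.single m (Poly_Mapping.lookup f m))"
        by (rule poly_mapping_expand) auto
      also have "\<dots> =
          (\<Sum>m\<in>Poly_Mapping.keys f. smult_mp (Poly_Mapping.lookup f m) (?b (nom m)))"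
        by (simp add: smult_mp_single)
      also have "\<dots> \<in> mp.span (?b ` ?S)"
        by (intro mp.span_sum mp.span_scale mp.span_base imageI poly_ring_homog_keys[OF f])
      finally show "f \<in> mp.span (?b ` ?S)" .
    qed
  qed
  then show ?thesis by (simp add: card_image[OF inj])
qed

section \<open>Ideals generated by differences of monomials\<close>

definition binomials :: "(pt multiset \<times> pt multiset) set \<Rightarrow> 'k::comm_ring_1 mpoly set" where
  "binomials R = {pmono x - pmono y | x y. (x, y) \<in> R}"

text \<open>The linear extension of \<open>brep\<close>: it models, inside the polynomial ring, the
  passage to the quotient by the binomial ideal.\<close>

definition collapse ::
    "(pt multiset \<times> pt multiset) set \<Rightarrow> 'k::comm_ring_1 mpoly \<Rightarrow> 'k mpoly" where
  "collapse R f = (\<Sum>m\<in>Poly_Mapping.keys f.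
     Poly_Mapping.single (mon (brep R (nom m))) (Poly_Mapping.lookup f m))"

text \<open>A common larger index set makes additivity visible although terms of a sum may
  cancel.\<close>

lemma collapse_superset:
  assumes "finite S" "Poly_Mapping.keys f \<subseteq> S"
  shows "collapse R f =
    (\<Sum>m\<in>S. Poly_Mapping.single (mon (brep R (nom m))) (Poly_Mapping.lookup f m))"
  unfolding collapse_def using assms
  by (intro sum.mono_neutral_left) (auto simp: in_keys_iff)

lemma collapse_zero [simp]: "collapse R 0 = 0"
  unfolding collapse_def by simp

lemma collapse_add: "collapse R (f + g) = collapse R f + collapse R g"
proof -
  let ?S = "Poly_Mapping.keys f \<union> Poly_Mapping.keys g"
  have "finite ?S" by simp
  moreover have "Poly_Mapping.keys (f + g) \<subseteq> ?S" by (rule keys_add)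
  ultimately show ?thesis
    by (subst (1 2 3) collapse_superset[of ?S]) (auto simp: lookup_add single_add sum.distrib)
qed

lemma collapse_single:
  "collapse R (Poly_Mapping.single m c) = Poly_Mapping.single (mon (brep R (nom m))) c"
  by (subst collapse_superset[of "{m}"]) auto

lemma collapse_sum: "collapse R (sum f S) = (\<Sum>i\<in>S. collapse R (f i))"
  by (induction S rule: infinite_finite_induct) (auto simp: collapse_add)

lemma collapse_diff: "collapse R (f - g) = collapse R f - collapse R g"
  using collapse_add[of R "f - g" g] by (simp add: algebra_simps)

text \<open>A monomial multiple of a generator is a difference of two congruent monomials, which
  collapse to the same one.\<close>

lemma collapse_ideal_gen:
  fixes f :: "'k::comm_ring_1 mpoly"
  assumes "f \<in> ideal_gen A (binomials R)"
  shows "collapse R f = 0"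
proof -
  have *: "collapse R (q * g) = 0" if gR: "g \<in> binomials R" for q g :: "'k mpoly"
  proof -
    obtain x y where g: "g = pmono x - pmono y" and xy: "(x, y) \<in> R"
      using gR unfolding binomials_def by blast
    have "q = (\<Sum>m\<in>Poly_Mapping.keys q. Poly_Mapping.single m (Poly_Mapping.lookup q m))"
      by (rule poly_mapping_expand) auto
    then have "q * g =
        (\<Sum>m\<in>Poly_Mapping.keys q. Poly_Mapping.single m (Poly_Mapping.lookup q m)) * g"
      by (rule arg_cong)
    also have "\<dots> = (\<Sum>m\<in>Poly_Mapping.keys q.
        Poly_Mapping.single (m + mon x) (Poly_Mapping.lookup q m)
      - Poly_Mapping.single (m + mon y) (Poly_Mapping.lookup q m))"
      unfolding g by (simp add: sum_distrib_right right_diff_distrib mult_single sum_subtractf)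
    finally have qg: "q * g = \<dots>" .
    have "brep R (nom m + x) = brep R (nom m + y)" for m
      using xy by (simp add: brep_eq_iff bcong_add bcong_rel)
    then show ?thesis
      unfolding qg by (simp add: collapse_sum collapse_diff collapse_single nom_add)
  qed
  obtain F q where "f = (\<Sum>g\<in>F. q g * g)" "F \<subseteq> binomials R"
    using assms unfolding ideal_gen_def by auto
  then show ?thesis using * by (auto simp: collapse_sum intro!: sum.neutral)
qed

lemma ideal_gen_zero: "0 \<in> ideal_gen A G"
  unfolding ideal_gen_def by (rule CollectI, rule exI[of _ "{}"]) auto

lemma ideal_gen_add:
  assumes "f \<in> ideal_gen (poly_ring V) G" "g \<in> ideal_gen (poly_ring V) G"
  shows "f + g \<in> ideal_gen (poly_ring V) G"
proof -
  obtain F p where F: "f = (\<Sum>g\<in>F. p g * g)" "finite F" "F \<subseteq> G" "\<forall>g\<in>F. p g \<in> poly_ring V"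
    using assms(1) unfolding ideal_gen_def by auto
  obtain H q where H: "g = (\<Sum>g\<in>H. q g * g)" "finite H" "H \<subseteq> G" "\<forall>g\<in>H. q g \<in> poly_ring V"
    using assms(2) unfolding ideal_gen_def by auto
  \<comment> \<open>\<open>ideal_gen\<close> allows one coefficient per generator, so both
    combinations are padded by zeros to the common set \<open>F \<union> H\<close>.\<close>
  let ?p = "\<lambda>g. if g \<in> F then p g else 0" and ?q = "\<lambda>g. if g \<in> H then q g else 0"
  have "f = (\<Sum>g\<in>F \<union> H. ?p g * g)"
    unfolding F using F(2) H(2) by (intro sum.mono_neutral_cong_left) auto
  moreover have "g = (\<Sum>g\<in>F \<union> H. ?q g * g)"
    unfolding H using F(2) H(2) by (intro sum.mono_neutral_cong_left) auto
  ultimately have "f + g = (\<Sum>g\<in>F \<union> H. (?p g + ?q g) * g)"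
    by (simp add: sum.distrib[symmetric] distrib_right)
  moreover have "0 \<in> poly_ring V" unfolding poly_ring_def by simp
  then have "\<forall>g\<in>F \<union> H. ?p g + ?q g \<in> poly_ring V"
    using F(4) H(4) by (auto intro!: add_in_poly_ring)
  ultimately show ?thesis unfolding ideal_gen_def using F H
    by (intro CollectI exI[of _ "F \<union> H"] exI[of _ "\<lambda>g. ?p g + ?q g"]) auto
qed

lemma ideal_gen_base: "q \<in> A \<Longrightarrow> g \<in> G \<Longrightarrow> q * g \<in> ideal_gen A G"
  unfolding ideal_gen_def by (rule CollectI, rule exI[of _ "{g}"]) auto

lemma ideal_gen_subset:
  assumes "f \<in> ideal_gen (poly_ring V) G" "G \<subseteq> poly_ring V"
  shows "f \<in> poly_ring V"
proof -
  obtain F p where F: "f = (\<Sum>g\<in>F. p g * g)" "finite F" "F \<subseteq> G" "\<forall>g\<in>F. p g \<in> poly_ring V"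
    using assms(1) unfolding ideal_gen_def by auto
  have "(\<Sum>g\<in>F. p g * g) \<in> poly_ring V" using F(2-)
  proof (induction F rule: finite_induct)
    case empty
    show ?case by (simp add: poly_ring_def)
  next
    case (insert g F)
    then show ?case using assms(2) by (auto intro!: add_in_poly_ring mult_in_poly_ring)
  qed
  then show ?thesis using F by simp
qed

text \<open>The differences along a chain of steps telescope; each is \<open>pmono U\<close> times a
  generator, with a minus sign if the relation is used backwards.\<close>

lemma bcong_diff_in_ideal:
  assumes "graded_on V R" "bcong R M N" "set_mset M \<subseteq> V"
  shows "(pmono M - pmono N :: 'k::comm_ring_1 mpoly) \<in> ideal_gen (poly_ring V) (binomials R)"
  using assms(2)
proof (induction rule: rtranclp_induct)
  case base
  show ?case by (simp add: ideal_gen_zero)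
next
  case (step N N')
  have N: "set_mset N \<subseteq> V" using step bcong_graded[OF assms(1)] assms(3) by blast
  obtain U x y where U: "(x, y) \<in> R \<or> (y, x) \<in> R" "N = U + x" "N' = U + y"
    using step(2) unfolding bstep_def by auto
  have XU: "pmono U \<in> poly_ring V" "- pmono U \<in> poly_ring V"
    using N U unfolding poly_ring_def by auto
  have "(pmono N - pmono N' :: 'k mpoly) \<in> ideal_gen (poly_ring V) (binomials R)"
  proof (cases "(x, y) \<in> R")
    case True
    then have "(pmono U * (pmono x - pmono y) :: 'k mpoly) \<in> ideal_gen (poly_ring V) (binomials R)"
      using XU by (intro ideal_gen_base) (auto simp: binomials_def)
    then show ?thesis by (simp add: U pmono_add right_diff_distrib)
  next
    case False
    then have "(- pmono U * (pmono y - pmono x) :: 'k mpoly) \<in> ideal_gen (poly_ring V) (binomials R)"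
      using XU U(1) by (intro ideal_gen_base) (auto simp: binomials_def)
    then show ?thesis by (simp add: U pmono_add right_diff_distrib)
  qed
  from ideal_gen_add[OF step.IH this] show ?case by simp
qed

lemma vdim_binomial_ideal:
  assumes "finite V" "graded_on V R"
  shows "vdim (ideal_gen (poly_ring V) (binomials R) \<inter> homog k :: 'k::field mpoly set) =
    card (monoms V k) - class_count V R k"
proof -
  let ?S = "{M \<in> monoms V k. brep R M \<noteq> M}"
  let ?b = "\<lambda>M. pmono M - pmono (brep R M) :: 'k mpoly"
  let ?I = "ideal_gen (poly_ring V) (binomials R) :: 'k mpoly set"
  have fin: "finite ?S" using finite_monoms[OF assms(1), of k] by simp
  have "Poly_Mapping.lookup (?b M) (mon N) = (if M = N then 1 else 0)"
    if "M \<in> ?S" "N \<in> ?S" for M N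
  proof -
    \<comment> \<open>Representatives are fixed by \<open>brep\<close>, so none of them is an index
      in \<open>?S\<close>.\<close>
    have "brep R M \<noteq> N" using that by auto
    then show ?thesis using that by (simp add: lookup_single lookup_minus when_def)
  qed
  then have inj: "inj_on ?b ?S" and indep: "\<not> mp.dependent (?b ` ?S)"
    using independent_imageI[OF fin, of ?b] by blast+
  have gens: "binomials R \<subseteq> (poly_ring V :: 'k mpoly set)"
  proof
    fix g :: "'k mpoly" assume "g \<in> binomials R"
    then obtain x y where g: "g = pmono x - pmono y" "(x, y) \<in> R" unfolding binomials_def by blast
    then have "set_mset x \<subseteq> V" "set_mset y \<subseteq> V" using assms(2) unfolding graded_on_def by auto
    then show "g \<in> poly_ring V" unfolding g by (intro diff_in_poly_ring pmono_in_poly_ring)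
  qed
  have "vdim (?I \<inter> homog k) = card (?b ` ?S)"
  proof (rule vdim_eq_card[OF _ _ indep])
    show "finite (?b ` ?S)" using fin by simp
    show "?b ` ?S \<subseteq> ?I \<inter> homog k"
    proof (clarify)
      fix M assume M: "M \<in> monoms V k"
      have "size (brep R M) = k" "size M = k"
        using brep_monoms[OF assms(2) M] M unfolding monoms_def by auto
      then have "(pmono (brep R M) :: 'k mpoly) \<in> homog k" "(pmono M :: 'k mpoly) \<in> homog k"
        by (auto simp: homog_def)
      then show "?b M \<in> ?I \<inter> homog k"
        using bcong_diff_in_ideal[OF assms(2) bcong_brep, of M] M diff_homog
        unfolding monoms_def by auto
    qed
    show "?I \<inter> homog k \<subseteq> mp.span (?b ` ?S)"
    proof
      fix f :: "'k mpoly" assume f: "f \<in> ?I \<inter> homog k"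
      have f': "f \<in> poly_ring V \<inter> homog k" using f ideal_gen_subset[OF _ gens] by auto
      have expand:
        "f = (\<Sum>m\<in>Poly_Mapping.keys f. Poly_Mapping.single m (Poly_Mapping.lookup f m))"
        by (rule poly_mapping_expand) auto
      have "collapse R f = 0" using f collapse_ideal_gen by auto
      \<comment> \<open>Subtracting zero in this form replaces each monomial of \<open>f\<close> by
        its difference from its representative, which is a basis element or zero.\<close>
      then have "f = f - collapse R f" by simp
      also have "\<dots> =
          (\<Sum>m\<in>Poly_Mapping.keys f. Poly_Mapping.single m (Poly_Mapping.lookup f m))
          - collapse R f"
        using expand by (rule arg_cong)
      also have "\<dots> = (\<Sum>m\<in>Poly_Mapping.keys f.
          smult_mp (Poly_Mapping.lookup f m) (?b (nom m)))"
        by (simp add: smult_mp_single collapse_def sum_subtractf mp.scale_right_diff_distrib)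
      also have "\<dots> \<in> mp.span (?b ` ?S)"
      proof (rule mp.span_sum)
        fix m assume m: "m \<in> Poly_Mapping.keys f"
        show "smult_mp (Poly_Mapping.lookup f m) (?b (nom m)) \<in> mp.span (?b ` ?S)"
        proof (cases "brep R (nom m) = nom m")
          case True
          then show ?thesis by (simp add: mp.span_zero)
        next
          case False
          then have "?b (nom m) \<in> ?b ` ?S" using poly_ring_homog_keys[OF f' m] by blast
          then show ?thesis by (intro mp.span_scale mp.span_base)
        qed
      qed
      finally show "f \<in> mp.span (?b ` ?S)" .
    qed
  qed
  then show ?thesis
    by (simp add: card_image[OF inj] card_non_representatives(1)[OF assms])
qed

section \<open>Inner minors as moves, cells by coordinates\<close>

definition rect_moves :: "pt set set \<Rightarrow> (pt multiset \<times> pt multiset) set" where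
  "rect_moves P =
    {({#a, b#}, {#(fst a, snd b), (fst b, snd a)#}) | a b. inner_interval P a b}"

lemma inner_minors_eq:
  "(inner_minors P :: 'k::comm_ring_1 mpoly set) = binomials (rect_moves P)"
proof -
  have "{#a#} + {#b#} = {#a, b#}" for a b :: pt by simp
  then have "(var a * var b :: 'k mpoly) = pmono {#a, b#}" for a b unfolding var_eq_pmono by (metis pmono_add)
  then show ?thesis unfolding inner_minors_def binomials_def rect_moves_def by auto blast
qed

definition cell :: "int \<Rightarrow> int \<Rightarrow> pt set" where
  "cell x y = lat_interval (x, y) (x + 1, y + 1)"

lemma is_cell_iff: "is_cell C \<longleftrightarrow> (\<exists>x y. C = cell x y)"
  unfolding is_cell_def cell_def by auto

lemma is_cell_cell [simp]: "is_cell (cell x y)"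
  unfolding is_cell_iff by blast

lemma mem_cell: "p \<in> cell x y \<longleftrightarrow> x \<le> fst p \<and> fst p \<le> x + 1 \<and> y \<le> snd p \<and> snd p \<le> y + 1"
  unfolding cell_def lat_interval_def by auto

lemma cell_eq: "cell x y = {(x, y), (x + 1, y), (x, y + 1), (x + 1, y + 1)}"
proof -
  have "p \<in> cell x y \<longleftrightarrow> p \<in> {(x, y), (x + 1, y), (x, y + 1), (x + 1, y + 1)}" for p
  proof -
    obtain s t where "p = (s, t)" by force
    moreover have "(x \<le> s \<and> s \<le> x + 1) = (s = x \<or> s = x + 1)"
       "(y \<le> t \<and> t \<le> y + 1) = (t = y \<or> t = y + 1)" by auto
    ultimately show ?thesis by (auto simp: mem_cell)
  qed
  then show ?thesis by blast
qed

lemma finite_cell: "finite (cell x y)"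
  by (simp add: cell_eq)

lemma cell_inj [simp]: "cell x y = cell x' y' \<longleftrightarrow> x = x' \<and> y = y'"
proof
  assume e: "cell x y = cell x' y'"
  have "(x, y) \<in> cell x y" "(x', y') \<in> cell x' y'"
    "(x + 1, y + 1) \<in> cell x y" "(x' + 1, y' + 1) \<in> cell x' y'" by (auto simp: mem_cell)
  then have "(x, y) \<in> cell x' y'" "(x', y') \<in> cell x y" using e by auto
  then show "x = x' \<and> y = y'" by (auto simp: mem_cell)
qed simp

lemma cell_subset_interval:
  "cell x y \<subseteq> lat_interval a b \<longleftrightarrow> fst a \<le> x \<and> x + 1 \<le> fst b \<and> snd a \<le> y \<and> y + 1 \<le> snd b"
  unfolding cell_eq lat_interval_def by auto

lemma inner_interval_iff:
  "inner_interval P a b \<longleftrightarrow> fst a < fst b \<and> snd a < snd b \<and>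
     (\<forall>x y. fst a \<le> x \<and> x < fst b \<and> snd a \<le> y \<and> y < snd b \<longrightarrow> cell x y \<in> P)"
proof -
  have "cell x y \<subseteq> lat_interval a b \<longleftrightarrow>
      fst a \<le> x \<and> x < fst b \<and> snd a \<le> y \<and> y < snd b" for x y
    unfolding cell_subset_interval by auto
  then show ?thesis unfolding inner_interval_def is_cell_iff by blast
qed

lemma inner_interval_corners:
  assumes "inner_interval P a b"
  shows "a \<in> vertices P" "b \<in> vertices P" "(fst a, snd b) \<in> vertices P" "(fst b, snd a) \<in> vertices P"
proof -
  have in_P: "cell (fst a) (snd a) \<in> P" "cell (fst b - 1) (snd b - 1) \<in> P"
    "cell (fst a) (snd b - 1) \<in> P" "cell (fst b - 1) (snd a) \<in> P"
    using assms unfolding inner_interval_iff by auto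
  show "a \<in> vertices P" "b \<in> vertices P" "(fst a, snd b) \<in> vertices P"
    "(fst b, snd a) \<in> vertices P"
    unfolding vertices_def
    by (rule UnionI, rule in_P(1), simp add: mem_cell)
      (rule UnionI, rule in_P(2), simp add: mem_cell,
       rule UnionI, rule in_P(3), simp add: mem_cell,
       rule UnionI, rule in_P(4), simp add: mem_cell)
qed

lemma graded_on_rect_moves: "graded_on (vertices P) (rect_moves P)"
  unfolding graded_on_def rect_moves_def using inner_interval_corners[of P] by auto

lemma finite_vertices:
  assumes "finite P" "\<forall>C\<in>P. is_cell C"
  shows "finite (vertices P)"
  using assms finite_cell unfolding vertices_def is_cell_iff by (metis finite_Union)

text \<open>Truncated subtraction is harmless here: there are at most as many classes as
  monomials.\<close>

lemma hilbert_fun_eq_class_count: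
  assumes "finite P" "\<forall>C\<in>P. is_cell C"
  shows "hilbert_fun K P k = class_count (vertices P) (rect_moves P) k"
  unfolding hilbert_fun_def polyomino_ideal_def inner_minors_eq
    vdim_poly_ring[OF finite_vertices[OF assms]]
    vdim_binomial_ideal[OF finite_vertices[OF assms] graded_on_rect_moves]
  using card_non_representatives(2)[OF finite_vertices[OF assms] graded_on_rect_moves] by simp

section \<open>Gluing along a variable\<close>

definition class_series :: "'a set \<Rightarrow> ('a multiset \<times> 'a multiset) set \<Rightarrow> int fps" where
  "class_series V R = Abs_fps (\<lambda>k. int (class_count V R k))"

lemma replicate_mset_add: "replicate_mset (i + j) x = replicate_mset i x + replicate_mset j x"
  by (simp add: multiset_eq_iff)

locale free_variable =
  fixes V :: "'a set" and R :: "('a multiset \<times> 'a multiset) set" and v :: 'a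
  assumes fin: "finite V" and graded: "graded_on V R" and v: "v \<in> V"
    and cancel: "set_mset M \<subseteq> V \<Longrightarrow> set_mset N \<subseteq> V \<Longrightarrow>
      bcong R (add_mset v M) (add_mset v N) \<Longrightarrow> bcong R M N"
begin

text \<open>Indivisibility by \<open>v\<close> in the quotient monoid, hence a property of the whole
  class and stronger than the absence of \<open>v\<close> from \<open>M\<close>.\<close>

definition reduced :: "'a multiset \<Rightarrow> bool" where
  "reduced M \<longleftrightarrow> (\<nexists>N. bcong R M (add_mset v N))"

definition splits :: "'a multiset \<Rightarrow> nat \<Rightarrow> 'a multiset \<Rightarrow> bool" where
  "splits M i N \<longleftrightarrow> reduced N \<and> bcong R M (replicate_mset i v + N)"

lemma bcong_vars: "bcong R M N \<Longrightarrow> set_mset M \<subseteq> V \<longleftrightarrow> set_mset N \<subseteq> V"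
  using bcong_graded[OF graded] by blast

lemma bcong_size: "bcong R M N \<Longrightarrow> size N = size M"
  using bcong_graded[OF graded] by blast

lemma reduced_bcong: "bcong R M N \<Longrightarrow> reduced M \<longleftrightarrow> reduced N"
  unfolding reduced_def by (meson bcong_sym rtranclp_trans)

text \<open>Copies of \<open>v\<close> are pulled out one by one; the congruence preserves size, so
  this terminates.\<close>

lemma splits_exists: "\<exists>i N. splits M i N"
proof (induction "size M" arbitrary: M rule: less_induct)
  case less
  show ?case
  proof (cases "reduced M")
    case True
    then show ?thesis unfolding splits_def by (intro exI[of _ 0] exI[of _ M]) simp
  next
    case False
    then obtain M' where M': "bcong R M (add_mset v M')" unfolding reduced_def by blast
    then have "size M' < size M" using bcong_size[OF M'] by simp
    then obtain i N where N: "reduced N" "bcong R M' (replicate_mset i v + N)"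
      using less unfolding splits_def by blast
    from bcong_add[OF N(2), of "{#v#}"] have "bcong R M (replicate_mset (Suc i) v + N)"
      using M' by (auto intro: rtranclp_trans)
    then show ?thesis using N(1) unfolding splits_def by blast
  qed
qed

lemma splits_vars: "splits M i N \<Longrightarrow> set_mset M \<subseteq> V \<Longrightarrow> set_mset N \<subseteq> V"
  unfolding splits_def using bcong_vars[of M "replicate_mset i v + N"] by auto

lemma splits_size: "splits M i N \<Longrightarrow> size M = i + size N"
  unfolding splits_def using bcong_size[of M "replicate_mset i v + N"] by auto

lemma cancel_power:
  assumes "set_mset M \<subseteq> V" "set_mset N \<subseteq> V"
    and "bcong R (replicate_mset i v + M) (replicate_mset i v + N)"
  shows "bcong R M N"
  using assms(3)
proof (induction i)
  case (Suc i)
  have "set_mset (replicate_mset i v + M) \<subseteq> V" "set_mset (replicate_mset i v + N) \<subseteq> V"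
    using assms v by (auto split: if_splits)
  then show ?case using Suc cancel by auto
qed simp

text \<open>After cancelling the smaller power, a surplus copy of \<open>v\<close> on the right
  would make the reduced \<open>M\<close> divisible by \<open>v\<close>.\<close>

lemma reduced_power_unique_le:
  assumes "set_mset M \<subseteq> V" "set_mset N \<subseteq> V" "reduced M" "i \<le> j"
    and eq: "bcong R (replicate_mset i v + M) (replicate_mset j v + N)"
  shows "i = j \<and> bcong R M N"
proof -
  obtain d where d: "j = i + d" using assms(4) le_Suc_ex by blast
  have "replicate_mset j v + N = replicate_mset i v + (replicate_mset d v + N)"
    unfolding d by (simp add: multiset_eq_iff)
  moreover have "set_mset (replicate_mset d v + N) \<subseteq> V" using assms v by auto
  ultimately have *: "bcong R M (replicate_mset d v + N)"
    using cancel_power assms(1) eq by metis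
  have "d = 0"
  proof (rule ccontr)
    assume "d \<noteq> 0"
    then obtain d' where "d = Suc d'" using not0_implies_Suc by blast
    then show False using * assms(3) unfolding reduced_def by auto
  qed
  then show ?thesis using * d by simp
qed

lemma reduced_power_unique:
  assumes "set_mset M \<subseteq> V" "set_mset N \<subseteq> V" "reduced M" "reduced N"
    and "bcong R (replicate_mset i v + M) (replicate_mset j v + N)"
  shows "i = j \<and> bcong R M N"
  using reduced_power_unique_le[of M N i j] reduced_power_unique_le[of N M j i] assms
    bcong_sym nat_le_linear by metis

definition reduced_count :: "nat \<Rightarrow> nat" where
  "reduced_count k = card {c \<in> brep R ` monoms V k. reduced c}"

end

locale glued = free_variable +
  fixes V' :: "'a set" and R' :: "('a multiset \<times> 'a multiset) set"
  assumes fin': "finite V'" and graded': "graded_on V' R'" and meet: "V \<inter> V' = {v}"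
begin

text \<open>The shared variable lies in \<open>V'\<close>, so \<open>outer\<close> never contains it
  and all its copies belong to \<open>inner\<close>.\<close>

definition outer :: "'a multiset \<Rightarrow> 'a multiset" where
  "outer M = filter_mset (\<lambda>x. x \<notin> V') M"

definition inner :: "'a multiset \<Rightarrow> 'a multiset" where
  "inner M = filter_mset (\<lambda>x. x \<in> V') M"

text \<open>The choice is a function of \<open>outer M\<close> alone, so moves within
  \<open>V'\<close> leave it unchanged.\<close>

definition split_of :: "'a multiset \<Rightarrow> nat \<times> 'a multiset" where
  "split_of M = (SOME (i, N). splits (outer M) i N)"

text \<open>Normal form: all copies of the shared variable are moved to the second factor.\<close>

definition glued_inv :: "'a multiset \<Rightarrow> 'a multiset \<times> 'a multiset" where
  "glued_inv M = (case split_of M of (i, N) \<Rightarrow>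
     (brep R N, brep R' (replicate_mset i v + inner M)))"

lemma glued_invE:
  obtains i N where "splits (outer M) i N"
    "glued_inv M = (brep R N, brep R' (replicate_mset i v + inner M))"
proof -
  have "\<exists>p. case p of (i, N) \<Rightarrow> splits (outer M) i N" using splits_exists[of "outer M"] by auto
  from someI_ex[OF this] have "case split_of M of (i, N) \<Rightarrow> splits (outer M) i N"
    unfolding split_of_def .
  then show ?thesis using that unfolding glued_inv_def by (auto split: prod.splits)
qed

lemma outer_inner: "outer M + inner M = M"
  unfolding outer_def inner_def by (metis add.commute multiset_partition)

lemma outer_add [simp]: "outer (M + N) = outer M + outer N"
  unfolding outer_def by simp

lemma inner_add [simp]: "inner (M + N) = inner M + inner N"
  unfolding inner_def by simp

lemma outer_vars: "set_mset M \<subseteq> V \<union> V' \<Longrightarrow> set_mset (outer M) \<subseteq> V"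
  unfolding outer_def by auto

lemma inner_vars: "set_mset (inner M) \<subseteq> V'"
  unfolding inner_def by auto

lemma outer_V': "set_mset M \<subseteq> V' \<Longrightarrow> outer M = {#}"
  unfolding outer_def by (auto simp: filter_mset_eq_conv)

lemma inner_V': "set_mset M \<subseteq> V' \<Longrightarrow> inner M = M"
  unfolding inner_def by (auto simp: filter_mset_eq_conv)

lemma inner_V:
  assumes "set_mset M \<subseteq> V"
  shows "inner M = replicate_mset (count M v) v"
proof (rule multiset_eqI)
  fix x
  show "count (inner M) x = count (replicate_mset (count M v) v) x"
    using assms meet unfolding inner_def by (cases "x \<in># M") (auto simp: not_in_iff)
qed

text \<open>A move may change the number of copies of \<open>v\<close>, and these sit in
  \<open>inner\<close>. Restoring them to the outer parts makes these congruent; unique splitting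
  then gives \<open>?s + i = ?t + j\<close>, so the total power of \<open>v\<close> handed to the
  second factor is the same.\<close>

lemma glued_inv_step1:
  assumes xy: "(x, y) \<in> R" and U: "set_mset (U + x) \<subseteq> V \<union> V'"
  shows "glued_inv (U + x) = glued_inv (U + y)"
proof -
  have V: "set_mset x \<subseteq> V" "set_mset y \<subseteq> V" using xy graded unfolding graded_on_def by auto
  have U': "set_mset (U + y) \<subseteq> V \<union> V'" using U V by auto
  obtain i M where M: "splits (outer (U + x)) i M"
    "glued_inv (U + x) = (brep R M, brep R' (replicate_mset i v + inner (U + x)))"
    by (rule glued_invE)
  obtain j N where N: "splits (outer (U + y)) j N"
    "glued_inv (U + y) = (brep R N, brep R' (replicate_mset j v + inner (U + y)))"
    by (rule glued_invE)
  let ?s = "count x v" and ?t = "count y v"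
  have x: "replicate_mset ?s v + outer x = x" and y: "replicate_mset ?t v + outer y = y"
    using outer_inner inner_V[OF V(1)] inner_V[OF V(2)] by (metis add.commute)+
  have "bcong R (replicate_mset ?s v + outer (U + x)) (replicate_mset (?s + i) v + M)"
    using bcong_add[of R "outer (U + x)" "replicate_mset i v + M" "replicate_mset ?s v"] M(1)
    unfolding splits_def by (simp add: replicate_mset_add add.assoc)
  moreover have "bcong R (replicate_mset ?t v + outer (U + y)) (replicate_mset (?t + j) v + N)"
    using bcong_add[of R "outer (U + y)" "replicate_mset j v + N" "replicate_mset ?t v"] N(1)
    unfolding splits_def by (simp add: replicate_mset_add add.assoc)
  moreover have "bcong R (outer U + x) (outer U + y)" using xy by (intro bcong_add bcong_rel)
  moreover have "replicate_mset ?s v + outer (U + x) = outer U + x"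
    "replicate_mset ?t v + outer (U + y) = outer U + y"
    using x y by (metis add.left_commute outer_add)+
  ultimately have "bcong R (replicate_mset (?s + i) v + M) (replicate_mset (?t + j) v + N)"
    by (metis bcong_sym rtranclp_trans)
  then have e: "?s + i = ?t + j" "bcong R M N"
    using reduced_power_unique[of M N "?s + i" "?t + j"] M(1) N(1) splits_vars outer_vars U U'
    unfolding splits_def by blast+
  have "replicate_mset i v + inner (U + x) = replicate_mset j v + inner (U + y)"
    using inner_V[OF V(1)] inner_V[OF V(2)] e(1)
    by (auto simp: multiset_eq_iff split: if_splits)
  then show ?thesis unfolding M(2) N(2) using e(2) by (metis brep_eq_iff)
qed

lemma glued_inv_step2:
  assumes xy: "(x, y) \<in> R'" and U: "set_mset (U + x) \<subseteq> V \<union> V'"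
  shows "glued_inv (U + x) = glued_inv (U + y)"
proof -
  have V: "set_mset x \<subseteq> V'" "set_mset y \<subseteq> V'" using xy graded' unfolding graded_on_def by auto
  have o: "outer (U + x) = outer (U + y)" using V by (simp add: outer_V')
  have s: "split_of (U + x) = split_of (U + y)" unfolding split_of_def o ..
  have "bcong R' (replicate_mset i v + inner (U + x)) (replicate_mset i v + inner (U + y))" for i
    unfolding inner_add inner_V'[OF V(1)] inner_V'[OF V(2)]
    by (intro bcong_add bcong_rel xy)
  then show ?thesis unfolding glued_inv_def s by (auto split: prod.splits simp: brep_eq_iff)
qed

lemma graded_glued: "graded_on (V \<union> V') (R \<union> R')"
  using graded graded' unfolding graded_on_def by blast

lemma glued_inv_bcong: "bcong (R \<union> R') M (fst (glued_inv M) + snd (glued_inv M))"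
proof -
  obtain i N where N: "splits (outer M) i N"
    "glued_inv M = (brep R N, brep R' (replicate_mset i v + inner M))"
    by (rule glued_invE)
  have "bcong (R \<union> R') (outer M) (replicate_mset i v + N)"
    using N(1) unfolding splits_def by (meson bcong_mono sup_ge1)
  from bcong_add2[OF this, of "inner M" "inner M"]
  have "bcong (R \<union> R') M (N + (replicate_mset i v + inner M))"
    using outer_inner[of M] by (simp add: add.assoc add.left_commute)
  moreover have "bcong (R \<union> R') N (brep R N)" by (meson bcong_mono bcong_brep sup_ge1)
  moreover have "bcong (R \<union> R') (replicate_mset i v + inner M) (brep R' (replicate_mset i v + inner M))"
    by (meson bcong_mono bcong_brep sup_ge2)
  ultimately show ?thesis unfolding N(2) fst_conv snd_conv by (meson bcong_add2 rtranclp_trans)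
qed

lemma glued_inv_complete:
  assumes M: "set_mset M \<subseteq> V \<union> V'" and N: "set_mset N \<subseteq> V \<union> V'"
  shows "glued_inv M = glued_inv N \<longleftrightarrow> bcong (R \<union> R') M N"
proof
  assume "glued_inv M = glued_inv N"
  then show "bcong (R \<union> R') M N" using glued_inv_bcong[of M] glued_inv_bcong[of N] by (metis bcong_sym rtranclp_trans)
next
  assume "bcong (R \<union> R') M N"
  then show "glued_inv M = glued_inv N"
  proof (induction rule: rtranclp_induct)
    case (step N N')
    have N: "set_mset N \<subseteq> V \<union> V'" "set_mset N' \<subseteq> V \<union> V'"
      using bcong_graded[OF graded_glued] M step(1,2) by (meson rtranclp.rtrancl_into_rtrancl)+
    obtain U x y where U: "(x, y) \<in> R \<union> R' \<or> (y, x) \<in> R \<union> R'" "N = U + x" "N' = U + y"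
      using step(2) unfolding bstep_def by blast
    have "glued_inv N = glued_inv N'"
      using U N glued_inv_step1 glued_inv_step2 by (metis UnE)
    then show ?case using step by simp
  qed simp
qed

lemma glued_inv_image:
  "glued_inv ` monoms (V \<union> V') k =
    (\<Union>i\<le>k. {c \<in> brep R ` monoms V i. reduced c} \<times> brep R' ` monoms V' (k - i))" (is "?L = ?T")
proof
  show "?L \<subseteq> ?T"
  proof
    fix p assume "p \<in> ?L"
    then obtain M where M: "p = glued_inv M" "set_mset M \<subseteq> V \<union> V'" "size M = k"
      unfolding monoms_def by auto
    obtain i N where N: "splits (outer M) i N"
      "glued_inv M = (brep R N, brep R' (replicate_mset i v + inner M))"
      by (rule glued_invE)
    have "set_mset N \<subseteq> V" using N(1) splits_vars outer_vars M(2) by blast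
    moreover have "reduced (brep R N)"
      using N(1) reduced_bcong[OF bcong_brep] unfolding splits_def by blast
    moreover have "size (outer M) + size (inner M) = k"
      using M(3) outer_inner[of M] by (metis size_union)
    then have "size N \<le> k" "i + size (inner M) = k - size N" using splits_size[OF N(1)] by auto
    moreover have "set_mset (replicate_mset i v + inner M) \<subseteq> V'" using inner_vars meet by auto
    ultimately show "p \<in> ?T" unfolding M(1) N(2) monoms_def by (auto intro!: bexI[of _ "size N"])
  qed
  show "?T \<subseteq> ?L"
  proof
    fix p assume "p \<in> ?T"
    then obtain i c d where i: "i \<le> k" "p = (c, d)" "reduced c" "c \<in> brep R ` monoms V i"
      "d \<in> brep R' ` monoms V' (k - i)" by auto
    then obtain D where D: "d = brep R' D" "set_mset D \<subseteq> V'" "size D = k - i"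
      unfolding monoms_def by auto
    have c: "set_mset c \<subseteq> V" "size c = i" "brep R c = c"
      using i(4) brep_monoms[OF graded] unfolding monoms_def by auto
    \<comment> \<open>A multiset containing \<open>v\<close> is trivially divisible by
      \<open>v\<close>. Hence \<open>c\<close> lies entirely in the outer part.\<close>
    have "v \<notin># c" using i(3) unfolding reduced_def by (metis insert_DiffM rtranclp.rtrancl_refl)
    then have ic: "inner c = {#}" using inner_V[OF c(1)] by (simp add: not_in_iff)
    then have oc: "outer c = c" using outer_inner[of c] by simp
    let ?M = "c + D"
    have M: "outer ?M = c" "inner ?M = D" by (simp_all add: ic oc outer_V' inner_V' D(2))
    obtain j N where N: "splits (outer ?M) j N"
      "glued_inv ?M = (brep R N, brep R' (replicate_mset j v + inner ?M))"
      by (rule glued_invE)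
    have "0 = j \<and> bcong R c N"
      using N(1) c(1) i(3) splits_vars[OF N(1)] unfolding M splits_def
      by (intro reduced_power_unique) auto
    then have "glued_inv ?M = p" unfolding N(2) M i(2) D(1)
      using c(3) brep_eq_iff[of R c N] by auto
    moreover have "?M \<in> monoms (V \<union> V') k" unfolding monoms_def using c D i(1) by auto
    ultimately show "p \<in> ?L" by blast
  qed
qed

lemma class_count_glued:
  "class_count (V \<union> V') (R \<union> R') k = (\<Sum>i\<le>k. reduced_count i * class_count V' R' (k - i))"
proof -
  have "class_count (V \<union> V') (R \<union> R') k = card (glued_inv ` monoms (V \<union> V') k)"
    by (rule class_count_eq_card_image) (use glued_inv_complete in \<open>auto simp: monoms_def\<close>)
  also have "\<dots> = (\<Sum>i\<le>k. card ({c \<in> brep R ` monoms V i. reduced c} \<times> brep R' ` monoms V' (k - i)))"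
    unfolding glued_inv_image
  proof (rule card_UN_disjoint)
    show "\<forall>i\<in>{..k}. finite ({c \<in> brep R ` monoms V i. reduced c} \<times> brep R' ` monoms V' (k - i))"
      using finite_monoms[OF fin] finite_monoms[OF fin']
      by (intro ballI finite_cartesian_product finite_imageI) (auto intro: finite_subset)
    have "size c = i" if "c \<in> brep R ` monoms V i" for c i
      using that brep_monoms[OF graded] unfolding monoms_def by auto
    then show "\<forall>i\<in>{..k}. \<forall>j\<in>{..k}. i \<noteq> j \<longrightarrow>
      ({c \<in> brep R ` monoms V i. reduced c} \<times> brep R' ` monoms V' (k - i)) \<inter>
      ({c \<in> brep R ` monoms V j. reduced c} \<times> brep R' ` monoms V' (k - j)) = {}" by blast
  qed simp
  finally show ?thesis
    by (simp add: card_cartesian_product reduced_count_def class_count_def)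
qed

lemma class_series_glued_reduced:
  "class_series (V \<union> V') (R \<union> R') = Abs_fps (\<lambda>k. int (reduced_count k)) * class_series V' R'"
  by (rule fps_ext)
    (simp add: class_series_def fps_mult_nth class_count_glued atLeast0AtMost)

end

context free_variable
begin

text \<open>Gluing a lone variable changes nothing, which computes the series of the reduced classes.\<close>

lemma class_series_reduced:
  "class_series V R * (1 - fps_X) = Abs_fps (\<lambda>k. int (reduced_count k))"
proof -
  interpret glued V R v "{v}" "{}"
    by unfold_locales (auto simp: v graded_on_def)
  have "monoms {v} k = {replicate_mset k v}" for k
    unfolding monoms_def by (auto simp: set_mset_subset_singletonD split: if_splits)
  then have "class_series {v} {} = Abs_fps (\<lambda>_. 1)"
    unfolding class_series_def class_count_def by simp
  moreover have "V \<union> {v} = V" using v by auto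
  ultimately have "class_series V R = Abs_fps (\<lambda>k. int (reduced_count k)) * Abs_fps (\<lambda>_. 1)"
    using class_series_glued_reduced by simp
  moreover have "Abs_fps (\<lambda>_. 1 :: int) * (1 - fps_X) = 1"
    by (rule fps_ext) (simp add: right_diff_distrib fps_eq_iff)
  ultimately show ?thesis by (simp add: mult.assoc)
qed

end

lemma (in glued) class_series_glued:
  "class_series (V \<union> V') (R \<union> R') = class_series V R * class_series V' R' * (1 - fps_X)"
  unfolding class_series_glued_reduced class_series_reduced[symmetric] by (simp add: mult_ac)

section \<open>Parity of closed walks and chords\<close>

definition hedge :: "pt set set \<Rightarrow> int \<Rightarrow> int \<Rightarrow> bool" where
  "hedge P x y \<longleftrightarrow> cell x y \<in> P \<or> cell x (y - 1) \<in> P"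

definition vedge :: "pt set set \<Rightarrow> int \<Rightarrow> int \<Rightarrow> bool" where
  "vedge P x y \<longleftrightarrow> cell x y \<in> P \<or> cell (x - 1) y \<in> P"

definition hlink :: "pt set set \<Rightarrow> pt \<Rightarrow> pt \<Rightarrow> bool" where
  "hlink P p q \<longleftrightarrow> snd p = snd q \<and>
     (\<forall>t. min (fst p) (fst q) \<le> t \<and> t < max (fst p) (fst q) \<longrightarrow> hedge P t (snd p))"

definition vlink :: "pt set set \<Rightarrow> pt \<Rightarrow> pt \<Rightarrow> bool" where
  "vlink P p q \<longleftrightarrow> fst p = fst q \<and>
     (\<forall>t. min (snd p) (snd q) \<le> t \<and> t < max (snd p) (snd q) \<longrightarrow> vedge P (fst p) t)"

text \<open>In the bipartite graph whose vertices are segments and whose edges are lattice points,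
  \<open>p\<close> and the corner share a vertical segment, the corner and \<open>q\<close> a
  horizontal one. The order of the legs makes points and corners alternate.\<close>

definition elink :: "pt set set \<Rightarrow> pt \<Rightarrow> pt \<Rightarrow> bool" where
  "elink P p q \<longleftrightarrow> vlink P p (fst p, snd q) \<and> hlink P (fst p, snd q) q"

lemma hlink_refl [simp]: "hlink P p p"
  unfolding hlink_def by auto

lemma vlink_refl [simp]: "vlink P p p"
  unfolding vlink_def by auto

lemma hlink_sym: "hlink P p q \<Longrightarrow> hlink P q p"
  unfolding hlink_def by (auto simp: min.commute max.commute)

lemma vlink_sym: "vlink P p q \<Longrightarrow> vlink P q p"
  unfolding vlink_def by (auto simp: min.commute max.commute)

lemma hlink_trans: "hlink P p q \<Longrightarrow> hlink P q r \<Longrightarrow> hlink P p r"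
  unfolding hlink_def by (auto simp: min_le_iff_disj less_max_iff_disj) (metis not_le)+

lemma vlink_trans: "vlink P p q \<Longrightarrow> vlink P q r \<Longrightarrow> vlink P p r"
  unfolding vlink_def by (auto simp: min_le_iff_disj less_max_iff_disj) (metis not_le)+

lemma hlink_snd: "hlink P p q \<Longrightarrow> snd p = snd q"
  unfolding hlink_def by simp

lemma vlink_fst: "vlink P p q \<Longrightarrow> fst p = fst q"
  unfolding vlink_def by simp

lemma vlink_between:
  assumes "vlink P p q" "min (snd p) (snd q) \<le> t" "t \<le> max (snd p) (snd q)"
  shows "vlink P (fst q, t) p"
  using assms unfolding vlink_def by (auto simp: min_le_iff_disj less_max_iff_disj le_max_iff_disj)

lemma hlink_cover:
  assumes "hlink P p q" "(fst p \<le> c) \<noteq> (fst q \<le> c)"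
  shows "hlink P (c, snd q) q"
  using assms unfolding hlink_def by (auto simp: min_le_iff_disj less_max_iff_disj)

lemma share_edge_adjacent:
  assumes "share_edge (cell x y) (cell x' y')"
  shows "\<bar>x - x'\<bar> + \<bar>y - y'\<bar> \<le> 1"
proof (rule ccontr)
  assume far: "\<not> ?thesis"
  have "cell x y \<inter> cell x' y' \<subseteq> {(max x x', max y y')}"
    using far by (auto simp: mem_cell)
  from card_mono[OF _ this] have "card (cell x y \<inter> cell x' y') \<le> 1" by simp
  then show False using assms unfolding share_edge_def by simp
qed

lemma share_edge_sym: "share_edge C D \<Longrightarrow> share_edge D C"
  unfolding share_edge_def by (simp add: Int_commute)

lemma share_edgeI:
  assumes "is_cell C" "p \<in> C" "p \<in> D" "q \<in> C" "q \<in> D" "p \<noteq> q"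
  shows "share_edge C D"
proof -
  have "finite (C \<inter> D)" using assms(1) finite_cell unfolding is_cell_iff by auto
  moreover have "{p, q} \<subseteq> C \<inter> D" using assms by auto
  ultimately have "card {p, q} \<le> card (C \<inter> D)" by (rule card_mono)
  then show ?thesis using assms(6) unfolding share_edge_def by simp
qed

lemma share_edge_right: "share_edge (cell x y) (cell (x + 1) y)"
  by (rule share_edgeI[of _ "(x + 1, y)" _ "(x + 1, y + 1)"]) (auto simp: mem_cell)

lemma share_edge_up: "share_edge (cell x y) (cell x (y + 1))"
  by (rule share_edgeI[of _ "(x, y + 1)" _ "(x + 1, y + 1)"]) (auto simp: mem_cell)

section \<open>Crossing parity of closed walks\<close>

fun wpar :: "('a \<Rightarrow> 'a \<Rightarrow> bool) \<Rightarrow> 'a list \<Rightarrow> bool" where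
  "wpar f (p # q # xs) = (f p q \<noteq> wpar f (q # xs))"
| "wpar f _ = False"

text \<open>The contributions of \<open>g\<close> telescope modulo 2, so only the end points matter
  and a closed walk has equal parities.\<close>

lemma wpar_coboundary:
  fixes g :: "'a \<Rightarrow> bool"
  assumes "\<And>p q. L p q \<Longrightarrow> f p q = (f' p q \<noteq> (g p \<noteq> g q))"
    and "successively L xs" "xs \<noteq> []"
  shows "wpar f xs = (wpar f' xs \<noteq> (g (hd xs) \<noteq> g (last xs)))"
  using assms(2,3)
proof (induction xs rule: induct_list012)
  case (3 p q xs)
  then have "wpar f (q # xs) = (wpar f' (q # xs) \<noteq> (g q \<noteq> g (last (q # xs))))" by simp
  moreover have "f p q = (f' p q \<noteq> (g p \<noteq> g q))" using assms(1) 3 by simp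
  ultimately show ?case by auto
qed auto

lemma wpar_card:
  "wpar f (map u [a..<a + Suc n]) = odd (card {i \<in> {a..<a + n}. f (u i) (u (Suc i))})"
proof (induction n arbitrary: a)
  case (Suc n)
  have "[a..<a + Suc (Suc n)] = a # Suc a # [Suc (Suc a)..<a + Suc (Suc n)]"
    "[Suc a..<Suc a + Suc n] = Suc a # [Suc (Suc a)..<a + Suc (Suc n)]"
    by (simp_all add: upt_conv_Cons)
  then have "wpar f (map u [a..<a + Suc (Suc n)]) =
      (f (u a) (u (Suc a)) \<noteq> wpar f (map u [Suc a..<Suc a + Suc n]))" by simp
  also have "\<dots> = (f (u a) (u (Suc a)) \<noteq>
      odd (card {i \<in> {Suc a..<Suc a + n}. f (u i) (u (Suc i))}))" by (subst Suc) simp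
  also have "\<dots> = odd (card {i \<in> {a..<a + Suc n}. f (u i) (u (Suc i))})"
  proof -
    let ?S = "{i \<in> {Suc a..<Suc a + n}. f (u i) (u (Suc i))}"
    have "{i \<in> {a..<a + Suc n}. f (u i) (u (Suc i))} =
        (if f (u a) (u (Suc a)) then insert a ?S else ?S)"
      by (auto simp: le_less Suc_le_eq)
    moreover have "finite ?S" "a \<notin> ?S" by auto
    ultimately show ?thesis by auto
  qed
  finally show ?case .
qed simp

text \<open>Whether the horizontal part of the step from \<open>p\<close> to \<open>q\<close> crosses the vertical ray going up
  from the cell with lower left corner \<open>(c, r)\<close>.\<close>

definition crosses :: "int \<Rightarrow> int \<Rightarrow> pt \<Rightarrow> pt \<Rightarrow> bool" where
  "crosses c r p q \<longleftrightarrow> r < snd q \<and> (fst p \<le> c) \<noteq> (fst q \<le> c)"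

text \<open>Only a horizontal leg at height exactly \<open>r + 1\<close> distinguishes the two rays,
  and over column \<open>c\<close> it would use an edge whose two cells are both empty.\<close>

lemma crosses_up:
  assumes "cell c r \<notin> P" "cell c (r + 1) \<notin> P" "elink P p q"
  shows "crosses c (r + 1) p q = crosses c r p q"
proof (rule ccontr)
  assume "\<not> ?thesis"
  then have "snd q = r + 1" "(fst p \<le> c) \<noteq> (fst q \<le> c)" unfolding crosses_def by auto
  then have "hedge P c (r + 1)" using assms(3) unfolding elink_def hlink_def by auto
  then show False using assms(1,2) unfolding hedge_def by simp
qed

text \<open>The two rays differ by the coboundary of the set of points on the line
  \<open>c + 1\<close> above \<open>r\<close>. It may be tested at \<open>p\<close> instead of the
  end of the vertical leg, because a leg on that line cannot pass the edge between the two empty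
  cells.\<close>

lemma crosses_right:
  assumes "cell c r \<notin> P" "cell (c + 1) r \<notin> P" "elink P p q"
  shows "crosses (c + 1) r p q =
    (crosses c r p q \<noteq> ((fst p = c + 1 \<and> r < snd p) \<noteq> (fst q = c + 1 \<and> r < snd q)))"
proof -
  have "(r < snd p) = (r < snd q)" if "fst p = c + 1"
  proof (rule ccontr)
    assume "\<not> ?thesis"
    then have "min (snd p) (snd q) \<le> r" "r < max (snd p) (snd q)" by auto
    then have "vedge P (c + 1) r" using assms(3) that unfolding elink_def vlink_def by auto
    then show False using assms(1,2) unfolding vedge_def by simp
  qed
  moreover have "(fst p \<le> c + 1) = (fst p \<le> c \<or> fst p = c + 1)"
    "(fst q \<le> c + 1) = (fst q \<le> c \<or> fst q = c + 1)" by auto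
  ultimately show ?thesis
    unfolding crosses_def by (cases "fst p = c + 1"; cases "fst q = c + 1"; cases "r < snd q") simp_all
qed

definition closed_walk :: "pt set set \<Rightarrow> pt list \<Rightarrow> bool" where
  "closed_walk P xs \<longleftrightarrow> xs \<noteq> [] \<and> hd xs = last xs \<and> successively (elink P) xs"

lemma wpar_crosses_adjacent:
  assumes w: "closed_walk P xs" and out: "cell c r \<notin> P" "cell c' r' \<notin> P"
    and "\<bar>c - c'\<bar> + \<bar>r - r'\<bar> \<le> 1"
  shows "wpar (crosses c r) xs = wpar (crosses c' r') xs"
proof -
  have up: "wpar (crosses c (r + 1)) xs = wpar (crosses c r) xs"
    if "cell c r \<notin> P" "cell c (r + 1) \<notin> P" for c r
    using wpar_coboundary[of "elink P" "crosses c (r + 1)" "crosses c r" "\<lambda>_. True" xs]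
      crosses_up[OF that] w unfolding closed_walk_def by simp
  have right: "wpar (crosses (c + 1) r) xs = wpar (crosses c r) xs"
    if "cell c r \<notin> P" "cell (c + 1) r \<notin> P" for c r
    using wpar_coboundary[of "elink P" "crosses (c + 1) r" "crosses c r"
        "\<lambda>p. fst p = c + 1 \<and> r < snd p" xs]
      crosses_right[OF that] w unfolding closed_walk_def by simp
  consider "c' = c" "r' = r" | "c' = c" "r' = r + 1" | "c' = c" "r = r' + 1"
    | "c' = c + 1" "r' = r" | "c = c' + 1" "r' = r" using assms(4) by linarith
  then show ?thesis using up right out by cases auto
qed

lemma wpar_crosses_outside:
  assumes "finite P" "simple P" and w: "closed_walk P xs" and out: "cell c r \<notin> P"
  shows "\<not> wpar (crosses c r) xs"
proof -
  define Y where "Y = Max (snd ` set xs)"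
  have xs: "xs \<noteq> []" using w unfolding closed_walk_def by simp
  have Y: "snd p \<le> Y" if "p \<in> set xs" for p unfolding Y_def using that by simp
  \<comment> \<open>A finite \<open>P\<close> cannot fill a whole column, and from height
    \<open>Y\<close> on no step of the walk crosses the ray.\<close>
  have "\<not> range (\<lambda>n. cell c (Y + int n)) \<subseteq> P"
    using assms(1) by (auto dest!: finite_subset simp: finite_image_iff inj_on_def)
  then obtain n where "cell c (Y + int n) \<notin> P" by auto
  then obtain R where R: "cell c R \<notin> P" "Y \<le> R" using that[of "Y + int n"] by simp
  have "\<not> wpar (crosses c R) xs"
  proof -
    have "\<not> wpar (crosses c R) ys" if "set ys \<subseteq> set xs" for ys
      using that
    proof (induction "crosses c R" ys rule: wpar.induct)
      case (1 p q ys)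
      then show ?case using Y[of q] R(2) unfolding crosses_def by auto
    qed auto
    then show ?thesis by simp
  qed
  moreover have "wpar (crosses c r) xs = wpar (crosses x y) xs"
    if "(\<lambda>X Y. is_cell X \<and> is_cell Y \<and> X \<notin> P \<and> Y \<notin> P \<and> share_edge X Y)\<^sup>*\<^sup>* (cell c r) (cell x y)"
    for x y
    using that
  proof (induction "cell x y" arbitrary: x y rule: rtranclp_induct)
    case (step C)
    then obtain x' y' where C: "C = cell x' y'" unfolding is_cell_iff by auto
    then show ?case using step share_edge_adjacent[of x' y' x y]
        wpar_crosses_adjacent[OF w, of x' y' x y] by auto
  qed simp
  moreover have "(\<lambda>X Y. is_cell X \<and> is_cell Y \<and> X \<notin> P \<and> Y \<notin> P \<and> share_edge X Y)\<^sup>*\<^sup>*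
      (cell c r) (cell c R)"
    using assms(2) out R(1) unfolding simple_def by simp
  ultimately show ?thesis by blast
qed

text \<open>Let \<open>x0\<close>, \<open>x1\<close> be the abscissae of the two vertical sides hanging from a topmost horizontal side.
  If the strip between them is filled by cells down to the higher of their lower ends, then the
  horizontal segment there is a chord. Otherwise the highest empty cell of the strip lies outside
  the cycle, so by parity a second horizontal side passes above it, and that side extends across
  the strip.\<close>

lemma chord_at_top:
  fixes u :: "nat \<Rightarrow> pt"
  assumes P: "finite P" "simple P" and n: "n \<ge> 3" and per: "\<And>i. u (i + n) = u i"
    and link: "\<And>i. elink P (u i) (u (Suc i))" and top: "\<And>i. snd (u i) \<le> snd (u 0)"
  shows "\<exists>i j. i < j \<and> j < i + n - 1 \<and>
    hlink P (fst (u j), snd (u i)) (u i) \<and> vlink P (fst (u j), snd (u i)) (u j)"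
proof (rule ccontr)
  \<comment> \<open>The horizontal segment of \<open>u i\<close> already meets the vertical one of
    \<open>u j\<close> on the cycle for \<open>j = i\<close> (at \<open>u i\<close>) and for
    \<open>j = i + n - 1\<close> (at the corner of the step into \<open>u i\<close>). The bounds on
    \<open>j\<close> exclude just these two.\<close>
  assume nochord: "\<not> ?thesis"
  have chord: False if "i < j" "j < i + n - 1"
    "hlink P (fst (u j), snd (u i)) (u i)" "vlink P (fst (u j), snd (u i)) (u j)" for i j
    using nochord that by blast
  have un: "u n = u 0" using per[of 0] by simp
  \<comment> \<open>Two points on one segment give a chord whose corner is one of them. The excluded
    index \<open>b = a + n - 1\<close> is avoided by exchanging the roles of the points, which is
    where \<open>n \<ge> 3\<close> enters. The same holds for \<open>nv\<close>.\<close>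
  have nh: False if "a < b" "b < a + n" "hlink P (u a) (u b)" for a b
  proof (cases "b < a + n - 1")
    case True
    have "(fst (u b), snd (u a)) = u b" using hlink_snd[OF that(3)] by (simp add: prod_eq_iff)
    then show False using chord[of a b] that True hlink_sym by simp
  next
    case False
    have "(fst (u a), snd (u b)) = u a" using hlink_snd[OF that(3)] by (simp add: prod_eq_iff)
    moreover have "b < a + n" "a + n < b + n - 1" using that(1,2) False n by linarith+
    ultimately show False using chord[of b "a + n"] that by (simp add: per)
  qed
  have nv: False if "a < b" "b < a + n" "vlink P (u a) (u b)" for a b
  proof (cases "b < a + n - 1")
    case True
    have "(fst (u b), snd (u a)) = u a" using vlink_fst[OF that(3)] by (simp add: prod_eq_iff)
    then show False using chord[of a b] that True by simp
  next
    case False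
    have "(fst (u a), snd (u b)) = u b" using vlink_fst[OF that(3)] by (simp add: prod_eq_iff)
    moreover have "b < a + n" "a + n < b + n - 1" using that(1,2) False n by linarith+
    ultimately show False using chord[of b "a + n"] that vlink_sym by (simp add: per)
  qed
  \<comment> \<open>The step from \<open>u (n - 1)\<close> to \<open>u n = u 0\<close> ends with the
    top side from \<open>(x1, Y)\<close> to \<open>(x0, Y)\<close>; the sides hanging from it end at
    \<open>(x0, y0)\<close> and \<open>(x1, y1)\<close>.\<close>
  define Y where "Y = snd (u 0)"
  define x0 where "x0 = fst (u 0)"
  define x1 where "x1 = fst (u (n - 1))"
  define y0 where "y0 = snd (u 1)"
  define y1 where "y1 = snd (u (n - 1))"
  define lo where "lo = min x0 x1"
  define hi where "hi = max x0 x1"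
  define m where "m = max y0 y1"
  have u0: "u 0 = (x0, Y)" and u1: "u (n - 1) = (x1, y1)"
    unfolding x0_def Y_def x1_def y1_def by simp_all
  have l0: "vlink P (x0, Y) (x0, y0)" "hlink P (x0, y0) (u 1)"
    using link[of 0] unfolding elink_def u0 y0_def by auto
  have l1: "vlink P (x1, y1) (x1, Y)" "hlink P (x1, Y) (x0, Y)"
    using link[of "n - 1"] n unfolding elink_def u1 by (auto simp: un u0)
  have npos: "0 < n" using n by simp
  have last: "n - 1 < n" "n < n - 1 + n" using n by linarith+
  have window: "1 < n - 1" "n - 1 < 1 + n - 1" "n < n - 1 + n - 1" using n by linarith+
  have "y0 \<noteq> Y" using l0(2) nh[of 0 1] n unfolding u0 by auto
  then have y0: "y0 < Y" using top[of 1] unfolding Y_def y0_def by simp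
  have "y1 \<noteq> Y" using l1(2) nh[OF last] unfolding u1 un u0 by auto
  then have y1: "y1 < Y" using top[of "n - 1"] unfolding Y_def y1_def by simp
  have "x0 \<noteq> x1" using l1(1) nv[OF last] unfolding u1 un u0 by auto
  then have lohi: "lo < hi" unfolding lo_def hi_def by auto
  have v0: "vlink P (x0, t) (u 0)" if "m \<le> t" "t < Y" for t
    using vlink_between[OF l0(1), of t] that unfolding u0 m_def by simp
  have v1: "vlink P (x1, t) (u (n - 1))" if "m \<le> t" "t < Y" for t
    using vlink_between[OF l1(1), of t] that unfolding u1 m_def by simp
  have strip: "hlink P (c, t) (x0, t) \<and> hlink P (c, t) (x1, t)"
    if "\<And>s. lo \<le> s \<Longrightarrow> s < hi \<Longrightarrow> hedge P s t" "lo \<le> c" "c \<le> hi" for c t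
    using that unfolding hlink_def lo_def hi_def
    by (auto simp: min_le_iff_disj less_max_iff_disj le_max_iff_disj)
  define B where "B = {(c, r). lo \<le> c \<and> c < hi \<and> m \<le> r \<and> r < Y \<and> cell c r \<notin> P}"
  have "B \<noteq> {}"
  proof
    assume "B = {}"
    \<comment> \<open>The full row above height \<open>m\<close> links both hanging sides. Since
      \<open>m\<close> is the height of \<open>u 1\<close> or of \<open>u (n - 1)\<close>, it
      prolongs a horizontal segment of the cycle to the opposite side.\<close>
    then have "cell s m \<in> P" if "lo \<le> s" "s < hi" for s
      using that y0 y1 unfolding B_def m_def by auto
    then have s: "hlink P (x0, m) (x1, m)" using strip[of m x0] unfolding hedge_def
      by (auto simp: lo_def hi_def)
    have mY: "m < Y" using y0 y1 unfolding m_def by simp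
    show False
    proof (cases "m = y0")
      case True
      then have "hlink P (x1, y0) (u 1)" using s l0(2) hlink_sym hlink_trans by metis
      then show False using chord[OF window(1,2)] v1[of m] mY
        unfolding x1_def[symmetric] y0_def[symmetric] True by simp
    next
      case False
      then have "m = y1" unfolding m_def by auto
      then show False using chord[OF last(1) window(3), unfolded un u0 u1] v0[of m] mY s
        unfolding u0 by simp
    qed
  qed
  moreover have "finite B"
    by (rule finite_subset[of _ "{lo..hi} \<times> {m..Y}"]) (auto simp: B_def)
  ultimately have "Max (snd ` B) \<in> snd ` B" "\<And>b. b \<in> B \<Longrightarrow> snd b \<le> Max (snd ` B)" by simp_all
  then obtain c r where cr: "(c, r) \<in> B" "\<And>b. b \<in> B \<Longrightarrow> snd b \<le> r" by auto
  have c: "lo \<le> c" "c < hi" "m \<le> r" "r < Y" "cell c r \<notin> P" using cr(1) unfolding B_def by auto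
  have "closed_walk P (map u [0..<0 + Suc n])"
    unfolding closed_walk_def using un link
    by (auto simp: successively_map hd_append last_map hd_map successively_conv_nth simp del: upt_Suc)
  from wpar_crosses_outside[OF P this c(5)]
  have even: "even (card {i \<in> {0..<0 + n}. crosses c r (u i) (u (Suc i))})"
    unfolding wpar_card by simp
  have "crosses c r (u (n - 1)) (u (Suc (n - 1)))"
    using n c
    unfolding crosses_def lo_def hi_def Suc_diff_1[OF npos] u1 un u0 by auto
  then have mem: "n - 1 \<in> {i \<in> {0..<0 + n}. crosses c r (u i) (u (Suc i))}" using n by simp
  have "{i \<in> {0..<0 + n}. crosses c r (u i) (u (Suc i))} \<noteq> {n - 1}"
    using even by (metis card.empty card_insert_disjoint empty_iff even_Suc even_zero finite.emptyI)
  then obtain i where i: "i < n" "i \<noteq> n - 1" "crosses c r (u i) (u (Suc i))" using mem by auto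
  define t where "t = snd (u (Suc i))"
  have j: "0 < Suc i" "Suc i \<le> n - 1" using i by auto
  have t: "r < t" using i(3) unfolding crosses_def t_def by simp
  have ct: "hlink P (c, t) (u (Suc i))"
    using hlink_cover[of P "(fst (u i), t)" "u (Suc i)" c] i(3) link[of i]
    unfolding elink_def crosses_def t_def by simp
  \<comment> \<open>A side at height \<open>Y\<close> over column \<open>c\<close> would share the
    segment of the top side, against \<open>nh\<close>.\<close>
  have "t \<noteq> Y"
  proof
    assume "t = Y"
    moreover have "hlink P (c, Y) (x0, Y)"
      using hlink_cover[OF l1(2), of c] c(1,2) unfolding lo_def hi_def
      by (auto simp: min_le_iff_disj less_max_iff_disj)
    ultimately have "hlink P (u (Suc i)) (u n)"
      using ct hlink_sym hlink_trans unfolding un u0 by metis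
    moreover have "Suc i < n" "n < Suc i + n" using j n by linarith+
    ultimately show False using nh by blast
  qed
  then have tY: "t < Y" using top[of "Suc i"] unfolding Y_def t_def by simp
  have "cell s t \<in> P" if "lo \<le> s" "s < hi" for s
  proof (rule ccontr)
    assume "cell s t \<notin> P"
    then have "(s, t) \<in> B" using that t tY c(3) unfolding B_def by auto
    then show False using cr(2) t by fastforce
  qed
  then have "hlink P (c, t) (x0, t)" "hlink P (c, t) (x1, t)"
    using strip[of t c] c(1,2) unfolding hedge_def by auto
  then have h: "hlink P (x0, t) (u (Suc i))" "hlink P (x1, t) (u (Suc i))"
    using ct hlink_sym hlink_trans by metis+
  have mt: "m \<le> t" using c(3) t by simp
  show False
  proof (cases "Suc i < n - 1")
    case True
    then have "n - 1 < Suc i + n - 1" by linarith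
    then show False using chord[OF True] h(2) v1[OF mt tY]
      unfolding t_def x1_def by simp
  next
    case False
    \<comment> \<open>Now the side at \<open>x1\<close> belongs to the same point as the horizontal
      one, so the chord goes to the side at \<open>x0\<close>, that of \<open>u n\<close>.\<close>
    then have e: "Suc i = n - 1" using j by simp
    show False using chord[OF last(1) window(3), unfolded un u0] h(1)[unfolded e] v0[OF mt tY]
      unfolding t_def e u0 by simp
  qed
qed

text \<open>Shifting the indices puts a topmost point at position 0; periodicity guarantees that one
  exists.\<close>

lemma chord:
  fixes u :: "nat \<Rightarrow> pt"
  assumes P: "finite P" "simple P" and n: "n \<ge> 3" and per: "\<And>i. u (i + n) = u i"
    and link: "\<And>i. elink P (u i) (u (Suc i))"
  shows "\<exists>i j. i < j \<and> j < i + n - 1 \<and>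
    hlink P (fst (u j), snd (u i)) (u i) \<and> vlink P (fst (u j), snd (u i)) (u j)"
proof -
  have mod: "u i = u (i mod n)" for i
  proof -
    have "u (i + k * n) = u i" for i k
      by (induction k) (auto simp: per add.assoc[symmetric] add.commute[of n])
    from this[of "i mod n" "i div n"] show ?thesis by simp
  qed
  let ?Y = "Max ((\<lambda>i. snd (u i)) ` {..<n})"
  have "?Y \<in> (\<lambda>i. snd (u i)) ` {..<n}" using n
    by (intro Max_in) (auto simp: lessThan_empty_iff)
  then obtain s where s: "snd (u s) = ?Y" by auto
  have "snd (u i) \<le> snd (u s)" for i unfolding s by (subst mod) (use n in auto)
  then obtain i j where ij: "i < j" "j < i + n - 1"
    "hlink P (fst (u (s + j)), snd (u (s + i))) (u (s + i))"
    "vlink P (fst (u (s + j)), snd (u (s + i))) (u (s + j))"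
    using chord_at_top[OF P n, of "\<lambda>i. u (s + i)"] link
    by (auto simp: add.assoc[symmetric] per)
  then show ?thesis by (intro exI[of _ "s + i"] exI[of _ "s + j"]) auto
qed

section \<open>Cycles as lists, and their corners\<close>

fun corners :: "pt list \<Rightarrow> pt list" where
  "corners (p # q # xs) = (fst p, snd q) # corners (q # xs)"
| "corners _ = []"

lemma corners_append: "corners (xs @ p # ys) = corners (xs @ [p]) @ corners (p # ys)"
  by (induction xs rule: corners.induct) auto

text \<open>Only the abscissa of the first point and the ordinate of the last one enter, so the
  corner of a chord can stand in for both end points.\<close>

lemma corners_cong:
  "fst p = fst p' \<Longrightarrow> snd q = snd q' \<Longrightarrow> corners (p # xs @ [q]) = corners (p' # xs @ [q'])"
proof (induction xs arbitrary: p p')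
  case (Cons x xs)
  then show ?case by (cases xs) auto
qed simp

lemma rotate_cycle:
  assumes "ps \<noteq> []" "successively (elink P) (ps @ [hd ps])"
  shows "successively (elink P) (rotate k ps @ [hd (rotate k ps)]) \<and>
    mset (corners (rotate k ps @ [hd (rotate k ps)])) = mset (corners (ps @ [hd ps]))"
proof (induction k)
  case 0
  then show ?case using assms by simp
next
  case (Suc k)
  define qs where "qs = rotate k ps"
  have step: "successively (elink P) (rotate1 qs @ [hd (rotate1 qs)]) \<and>
    mset (corners (rotate1 qs @ [hd (rotate1 qs)])) = mset (corners (qs @ [hd qs]))"
    if "successively (elink P) (qs @ [hd qs])"
  proof (cases qs)
    case (Cons q rs)
    show ?thesis
    proof (cases rs)
      case (Cons r ts)
      have "corners ((r # ts) @ q # [r]) = corners ((r # ts) @ [q]) @ corners [q, r]"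
        by (rule corners_append)
      then show ?thesis using that \<open>qs = q # rs\<close> Cons
        by (auto simp: successively_append_iff successively_Cons hd_append)
    qed (use Cons that in auto)
  qed (use that in auto)
  then show ?case using Suc unfolding qs_def by simp
qed

text \<open>The horizontal legs of the walk \<open>p\<close>, \<open>q\<close>, \<open>p\<close> lie
  at the heights of \<open>q\<close> and \<open>p\<close>. Exactly one passes above the cell, an odd
  parity that no empty cell admits.\<close>

lemma rectangle_inner:
  assumes P: "finite P" "simple P" and pq: "elink P p q" "elink P q p"
    and xy: "min (fst p) (fst q) \<le> x" "x < max (fst p) (fst q)"
      "min (snd p) (snd q) \<le> y" "y < max (snd p) (snd q)"
  shows "cell x y \<in> P"
proof (rule ccontr)
  assume out: "cell x y \<notin> P"
  have "closed_walk P [p, q, p]" unfolding closed_walk_def using pq by simp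
  from wpar_crosses_outside[OF P this out] show False
    using xy unfolding crosses_def by auto
qed

text \<open>If \<open>p\<close> and \<open>q\<close> are aligned, both sides are the same multiset.
  Otherwise they are diagonal or anti-diagonal corners of an inner interval, and the relation is
  used in the matching direction.\<close>

lemma two_cycle_bcong:
  assumes P: "finite P" "simple P" and pq: "elink P p q" "elink P q p"
  shows "bcong (rect_moves P) {#p, q#} {#(fst p, snd q), (fst q, snd p)#}"
proof (cases "fst p = fst q \<or> snd p = snd q")
  case True
  then have "(fst p, snd q) = q \<and> (fst q, snd p) = p \<or> (fst p, snd q) = p \<and> (fst q, snd p) = q"
    by (auto simp: prod_eq_iff)
  then have "{#p, q#} = {#(fst p, snd q), (fst q, snd p)#}" by (auto simp: add_mset_commute)
  then show ?thesis by simp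
next
  case False
  define a where "a = (min (fst p) (fst q), min (snd p) (snd q))"
  define b where "b = (max (fst p) (fst q), max (snd p) (snd q))"
  have "inner_interval P a b"
    unfolding inner_interval_iff a_def b_def using rectangle_inner[OF P pq] False by auto
  then have "({#a, b#}, {#(fst a, snd b), (fst b, snd a)#}) \<in> rect_moves P"
    unfolding rect_moves_def by blast
  then have *: "bcong (rect_moves P) {#a, b#} {#(fst a, snd b), (fst b, snd a)#}" by (rule bcong_rel)
  obtain px py qx qy where e: "p = (px, py)" "q = (qx, qy)" by force
  consider "px < qx" "py < qy" | "px < qx" "qy < py" | "qx < px" "py < qy" | "qx < px" "qy < py"
    using False e by fastforce
  then show ?thesis
  proof cases
    case 1
    then show ?thesis using * unfolding a_def b_def e by (simp add: add_mset_commute)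
  next
    case 2
    then show ?thesis using bcong_sym[OF *] unfolding a_def b_def e by (simp add: add_mset_commute)
  next
    case 3
    then show ?thesis using bcong_sym[OF *] unfolding a_def b_def e by (simp add: add_mset_commute)
  next
    case 4
    then show ?thesis using * unfolding a_def b_def e by (simp add: add_mset_commute)
  qed
qed

section \<open>Cancellation\<close>

text \<open>A chord from \<open>p\<close> to the vertical segment of \<open>r\<close> cuts the cycle into two shorter ones, both
  containing the corner \<open>e\<close> of the chord, once on either side of the congruence.\<close>

lemma cut_cycle_bcong:
  assumes cyc: "successively (elink P) (p # A @ r # B @ [p])" and B: "B \<noteq> []"
    and chord: "hlink P (fst r, snd p) p" "vlink P (fst r, snd p) r"
    and IH: "\<And>ps. length ps < length (p # A @ r # B) \<Longrightarrow> ps \<noteq> [] \<Longrightarrow>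
      successively (elink P) (ps @ [hd ps]) \<Longrightarrow>
      bcong (rect_moves P) (mset ps) (mset (corners (ps @ [hd ps])))"
  shows "bcong (rect_moves P) (mset (p # A @ r # B)) (mset (corners (p # A @ r # B @ [p])))"
proof -
  define e where "e = (fst r, snd p)"
  define K where "K = corners (p # A @ [r])"
  define L where "L = corners (r # B @ [p])"
  obtain b B' where b: "B = b # B'" using B by (cases B) auto
  have parts: "successively (elink P) (p # A @ [r])" "elink P r b"
    "successively (elink P) B" "elink P (last B) p"
    using cyc by (auto simp: successively_append_iff successively_Cons b hd_append split: if_splits)
  have "elink P r p" unfolding elink_def using chord vlink_sym by blast
  then have "successively (elink P) ((p # A @ [r]) @ [hd (p # A @ [r])])"
    using parts(1) by (auto simp: successively_append_iff successively_Cons hd_append)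
  from IH[OF _ _ this] have 1: "bcong (rect_moves P) (mset (p # A @ [r])) (mset K + {#e#})"
    using B corners_append[of "p # A" r "[p]"] unfolding K_def e_def by simp
  \<comment> \<open>\<open>e\<close> is on the vertical segment of \<open>r\<close> and the
    horizontal segment of \<open>p\<close>, so it can replace \<open>r\<close> when leaving and
    \<open>p\<close> when arriving.\<close>
  have "elink P e b"
    using parts(2) vlink_trans[OF chord(2)] unfolding elink_def e_def by simp
  moreover have "elink P (last B) e"
    using parts(4) hlink_trans[OF _ hlink_sym[OF chord(1)]] unfolding elink_def e_def by simp
  ultimately have "successively (elink P) ((e # B) @ [hd (e # B)])"
    using parts(3) by (auto simp: successively_append_iff successively_Cons b hd_append)
  from IH[OF _ _ this] have "bcong (rect_moves P) (mset (e # B)) (mset (corners (e # B @ [e])))"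
    by simp
  moreover have "corners (e # B @ [e]) = L"
    unfolding L_def by (rule corners_cong) (simp_all add: e_def)
  ultimately have 2: "bcong (rect_moves P) (mset (e # B)) (mset L)" by simp
  have "bcong (rect_moves P) (mset (p # A @ [r]) + mset B) (mset K + mset (e # B))"
    using bcong_add2[OF 1, of "mset B" "mset B"] by simp
  moreover have "bcong (rect_moves P) (mset K + mset (e # B)) (mset K + mset L)"
    using 2 by (rule bcong_add)
  ultimately have "bcong (rect_moves P) (mset (p # A @ [r]) + mset B) (mset K + mset L)"
    by (rule rtranclp_trans)
  moreover have "corners (p # A @ r # B @ [p]) = K @ L"
    using corners_append[of "p # A" r "B @ [p]"] unfolding K_def L_def by simp
  ultimately show ?thesis by (simp add: add_mset_commute)
qed

lemma cycle_bcong: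
  assumes P: "finite P" "simple P"
  shows "ps \<noteq> [] \<Longrightarrow> successively (elink P) (ps @ [hd ps]) \<Longrightarrow>
    bcong (rect_moves P) (mset ps) (mset (corners (ps @ [hd ps])))"
proof (induction "length ps" arbitrary: ps rule: less_induct)
  case less
  consider "length ps = 1" | "length ps = 2" | "length ps \<ge> 3"
    using less(2) by (cases "length ps"; cases "length ps - 1"; cases "length ps - 2") auto
  then show ?case
  proof cases
    case 1
    then obtain p where "ps = [p]" by (auto simp: length_Suc_conv)
    then show ?thesis by simp
  next
    case 2
    then obtain p q where ps: "ps = [p, q]" by (auto simp: numeral_2_eq_2 length_Suc_conv)
    then show ?thesis using less(3) two_cycle_bcong[OF P, of p q] by simp
  next
    case 3
    define n where "n = length ps"
    define u where "u i = ps ! (i mod n)" for i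
    have n: "n \<ge> 3" using 3 unfolding n_def .
    have "elink P (u i) (u (Suc i))" for i
    proof -
      have "i mod n < n" using n by simp
      then have "elink P ((ps @ [hd ps]) ! (i mod n)) ((ps @ [hd ps]) ! Suc (i mod n))"
        using less(3) unfolding successively_conv_nth n_def by simp
      moreover have "(ps @ [hd ps]) ! Suc (i mod n) = u (Suc i)"
      proof (cases "Suc (i mod n) = n")
        case True
        then show ?thesis
          using less(2) unfolding u_def mod_Suc by (simp add: nth_append hd_conv_nth n_def)
      next
        case False
        then have "Suc (i mod n) < length ps" using \<open>i mod n < n\<close> unfolding n_def by simp
        then show ?thesis using False unfolding u_def mod_Suc by (simp add: nth_append)
      qed
      ultimately show ?thesis using \<open>i mod n < n\<close> unfolding u_def by (simp add: nth_append n_def)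
    qed
    then obtain i j where ij: "i < j" "j < i + n - 1"
      "hlink P (fst (u j), snd (u i)) (u i)" "vlink P (fst (u j), snd (u i)) (u j)"
      using chord[OF P n, of u] unfolding u_def by auto
    define qs where "qs = rotate i ps"
    define d where "d = j - i"
    have len: "length qs = n" unfolding qs_def n_def by simp
    \<comment> \<open>\<open>d < n - 1\<close> leaves points behind \<open>u j\<close>, so the piece
      ending there is really shorter than the cycle.\<close>
    have d: "0 < d" "d < n - 1" using ij unfolding d_def by auto
    have nth: "qs ! k = u (i + k)" if "k < n" for k
      using that unfolding qs_def u_def n_def by (simp add: nth_rotate)
    have "qs = take d qs @ qs ! d # drop (Suc d) qs" using d len by (intro id_take_nth_drop) simp
    moreover obtain p A where "take d qs = p # A" using d len by (cases "take d qs") auto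
    moreover have "qs ! d = u j" using nth[of d] d unfolding d_def using ij(1) by simp
    ultimately obtain B where qs: "qs = p # A @ u j # B" and B: "B = drop (Suc d) qs" by auto
    have p: "p = u i" using nth[of 0] n qs by simp
    have "B \<noteq> []" using d len unfolding B by simp
    have rot: "successively (elink P) (qs @ [hd qs])"
        "mset (corners (qs @ [hd qs])) = mset (corners (ps @ [hd ps]))"
      using rotate_cycle[OF less(2,3), of i] unfolding qs_def by auto
    have "bcong (rect_moves P) (mset qs) (mset (corners (qs @ [hd qs])))"
      using cut_cycle_bcong[of P p A "u j" B] rot(1) \<open>B \<noteq> []\<close> ij(3,4) less(1) len
      unfolding qs p n_def by simp
    moreover have "mset qs = mset ps"
      unfolding qs_def rotate_drop_take by (metis add.commute append_take_drop_id mset_append)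
    ultimately show ?thesis unfolding rot(2) by simp
  qed
qed

text \<open>Equality of the images in the edge ring of the bipartite graph of segments; a segment is
  named by any point \<open>p\<close> on it.\<close>

definition same_degrees :: "pt set set \<Rightarrow> pt multiset \<Rightarrow> pt multiset \<Rightarrow> bool" where
  "same_degrees P M N \<longleftrightarrow>
    (\<forall>p. size (filter_mset (hlink P p) M) = size (filter_mset (hlink P p) N) \<and>
         size (filter_mset (vlink P p) M) = size (filter_mset (vlink P p) N))"

lemma same_degrees_add:
  "same_degrees P (U + M) (U + N) \<longleftrightarrow> same_degrees P M N"
  unfolding same_degrees_def by simp

lemma same_degrees_trans: "same_degrees P L M \<Longrightarrow> same_degrees P M N \<Longrightarrow> same_degrees P L N"
  unfolding same_degrees_def by simp

lemma same_degrees_sym: "same_degrees P M N \<Longrightarrow> same_degrees P N M"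
  unfolding same_degrees_def by simp

lemma rect_moves_same_degrees:
  assumes "(x, y) \<in> rect_moves P"
  shows "same_degrees P x y"
proof -
  obtain a b where xy: "x = {#a, b#}" "y = {#(fst a, snd b), (fst b, snd a)#}"
    and ab: "inner_interval P a b"
    using assms unfolding rect_moves_def by auto
  have h: "hlink P a (fst b, snd a)" "hlink P b (fst a, snd b)"
    and v: "vlink P a (fst a, snd b)" "vlink P b (fst b, snd a)"
    using ab unfolding inner_interval_iff hlink_def vlink_def hedge_def vedge_def by auto
  have "hlink P p a = hlink P p (fst b, snd a)" "hlink P p b = hlink P p (fst a, snd b)"
    "vlink P p a = vlink P p (fst a, snd b)" "vlink P p b = vlink P p (fst b, snd a)" for p
    using h v by (meson hlink_trans hlink_sym vlink_trans vlink_sym)+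
  then show ?thesis unfolding same_degrees_def xy by auto
qed

lemma bcong_same_degrees: "bcong (rect_moves P) M N \<Longrightarrow> same_degrees P M N"
proof (induction rule: rtranclp_induct)
  case base
  show ?case unfolding same_degrees_def by simp
next
  case (step N N')
  then obtain U x y where U: "(x, y) \<in> rect_moves P \<or> (y, x) \<in> rect_moves P"
    "N = U + x" "N' = U + y" unfolding bstep_def by blast
  then have "same_degrees P N N'"
    using rect_moves_same_degrees same_degrees_sym same_degrees_add by metis
  then show ?case using step.IH same_degrees_trans by blast
qed

text \<open>Among all periodic points one of least period is taken; a repetition within its orbit
  would give a smaller period.\<close>

lemma obtain_orbit:
  assumes "finite S" "S \<noteq> {}" "f ` S \<subseteq> S"
  obtains x n where "x \<in> S" "n \<ge> 1" "(f ^^ n) x = x" "inj_on (\<lambda>i. (f ^^ i) x) {..<n}"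
proof -
  obtain a where a: "a \<in> S" using assms(2) by blast
  have mem: "(f ^^ i) x \<in> S" if "x \<in> S" for i x using that assms(3) by (induction i) auto
  define Q where "Q n \<longleftrightarrow> n \<ge> 1 \<and> (\<exists>x\<in>S. (f ^^ n) x = x)" for n
  have period: "Q (j - i)" if "i < j" "(f ^^ i) x = (f ^^ j) x" "x \<in> S" for i j x
  proof -
    have "(f ^^ (j - i)) ((f ^^ i) x) = (f ^^ i) x"
      using that by (metis add_diff_inverse_nat add.commute comp_apply funpow_add less_imp_not_less)
    then show ?thesis unfolding Q_def using mem that by fastforce
  qed
  have "\<not> inj (\<lambda>i. (f ^^ i) a)"
    using assms(1) mem[OF a] by (metis finite_subset image_subsetI finite_imageD infinite_UNIV_nat)
  then obtain i j where "i < j" "(f ^^ i) a = (f ^^ j) a"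
    unfolding inj_def by (metis linorder_neqE_nat)
  then have "\<exists>n. Q n" using period a by blast
  then have L: "Q (Least Q)" "\<And>m. m < Least Q \<Longrightarrow> \<not> Q m" using LeastI_ex not_less_Least by auto
  then obtain x where x: "x \<in> S" "(f ^^ Least Q) x = x" "Least Q \<ge> 1" unfolding Q_def by auto
  have "inj_on (\<lambda>i. (f ^^ i) x) {..<Least Q}"
  proof (rule linorder_inj_onI)
    fix i j assume "i < j" "j \<in> {..<Least Q}"
    then show "(f ^^ i) x \<noteq> (f ^^ j) x" using period[of i j x] x(1) L(2)[of "j - i"] by auto
  qed auto
  then show thesis using that x by blast
qed

lemma mset_subset_if_distinct: "distinct xs \<Longrightarrow> set xs \<subseteq> set_mset M \<Longrightarrow> mset xs \<subseteq># M"
  by (metis finite_set_mset mset_set_set mset_set_set_mset_msubset subset_imp_msubset_mset_set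
      subset_mset.order_trans)

text \<open>Equal degrees give each point of \<open>M\<close> a partner in \<open>N\<close> on its
  vertical segment, and each point of \<open>N\<close> one in \<open>M\<close> on its horizontal
  segment. Alternating these choices is a self-map of \<open>M\<close>, and a periodic orbit of it
  is the cycle. Distinctness makes points and corners submultisets.\<close>

lemma obtain_common_cycle:
  assumes deg: "same_degrees P M N" and M: "M \<noteq> {#}"
  obtains ps where "ps \<noteq> []" "successively (elink P) (ps @ [hd ps])" "mset ps \<subseteq># M"
    "mset (corners (ps @ [hd ps])) \<subseteq># N"
proof -
  have fwd: "\<exists>q. q \<in># N \<and> vlink P p q" if "p \<in># M" for p
  proof -
    have "p \<in># filter_mset (vlink P p) M" using that by simp
    then have "filter_mset (vlink P p) N \<noteq> {#}"
      using deg unfolding same_degrees_def by (metis size_eq_0_iff_empty empty_iff set_mset_empty)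
    then obtain q where "q \<in># filter_mset (vlink P p) N" by blast
    then have "q \<in># N \<and> vlink P p q" by simp
    then show ?thesis ..
  qed
  have bwd: "\<exists>p. p \<in># M \<and> hlink P q p" if "q \<in># N" for q
  proof -
    have "q \<in># filter_mset (hlink P q) N" using that by simp
    then have "filter_mset (hlink P q) M \<noteq> {#}"
      using deg unfolding same_degrees_def by (metis size_eq_0_iff_empty empty_iff set_mset_empty)
    then obtain p where "p \<in># filter_mset (hlink P q) M" by blast
    then have "p \<in># M \<and> hlink P q p" by simp
    then show ?thesis ..
  qed
  obtain s where s: "\<And>p. p \<in># M \<Longrightarrow> s p \<in># N \<and> vlink P p (s p)" using fwd by metis
  obtain t where t: "\<And>q. q \<in># N \<Longrightarrow> t q \<in># M \<and> hlink P q (t q)" using bwd by metis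
  define f where "f p = t (s p)" for p
  have fM: "f p \<in># M" if "p \<in># M" for p using s t that unfolding f_def by metis
  then have "f ` set_mset M \<subseteq> set_mset M" by (rule image_subsetI)
  moreover have "set_mset M \<noteq> {}" using M by simp
  ultimately obtain x n where x: "x \<in># M" "n \<ge> 1" "(f ^^ n) x = x"
    "inj_on (\<lambda>i. (f ^^ i) x) {..<n}"
    using obtain_orbit[of "set_mset M" f] by blast
  have mem: "(f ^^ i) x \<in># M" for i by (induction i) (simp_all add: x(1) fM)
  define ps where "ps = map (\<lambda>i. (f ^^ i) x) [0..<n]"
  have hd: "hd ps = x" unfolding ps_def using x(2) by (simp add: hd_map)
  have ps': "ps @ [hd ps] = map (\<lambda>i. (f ^^ i) x) [0..<Suc n]"
    unfolding hd unfolding ps_def using x(3) by simp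
  \<comment> \<open>\<open>s p\<close> has the abscissa of \<open>p\<close> and the ordinate of
    \<open>f p\<close>, so it is the corner of that step.\<close>
  have corner: "(fst p, snd (f p)) = s p" if "p \<in># M" for p
    using s[OF that] t[of "s p"] vlink_fst hlink_snd unfolding f_def by (metis prod.collapse)
  have "elink P p (f p)" if "p \<in># M" for p
    unfolding elink_def corner[OF that] using s[OF that] t unfolding f_def by auto
  then have link: "successively (elink P) (ps @ [hd ps])"
    unfolding ps' successively_map successively_conv_nth using mem by (auto simp del: upt_Suc)
  have corners: "corners (map (\<lambda>i. (f ^^ i) x) [k..<k + Suc m]) = map (\<lambda>i. s ((f ^^ i) x)) [k..<k + m]"
    for k m
  proof (induction m arbitrary: k)
    case (Suc m)
    have "[k..<k + Suc (Suc m)] = k # Suc k # [Suc (Suc k)..<k + Suc (Suc m)]"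
      "[Suc k..<Suc k + Suc m] = Suc k # [Suc (Suc k)..<k + Suc (Suc m)]"
      "[k..<k + Suc m] = k # [Suc k..<Suc k + m]"
      by (simp_all add: upt_conv_Cons)
    then show ?case using Suc[of "Suc k"] corner[OF mem[of k]] by simp
  qed simp
  have cs: "corners (ps @ [hd ps]) = map s ps"
    unfolding ps' using corners[of 0 n] unfolding ps_def by simp
  have dist: "distinct ps" unfolding ps_def distinct_map using x(4) by (simp add: atLeast0LessThan)
  have "inj_on s (set ps)"
  proof (rule inj_onI)
    fix p q assume pq: "p \<in> set ps" "q \<in> set ps" "s p = s q"
    then obtain i j where ij: "i < n" "j < n" "p = (f ^^ i) x" "q = (f ^^ j) x"
      unfolding ps_def by auto
    \<comment> \<open>On the orbit, \<open>f\<close> is inverted by its power \<open>n - 1\<close>;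
      so it is injective there, and \<open>s\<close> with it.\<close>
    have shift: "(f ^^ (n - 1)) (f ((f ^^ i) x)) = (f ^^ i) x" for i
    proof -
      have "(f ^^ (n - 1)) (f y) = (f ^^ n) y" for y
        using x(2) by (cases n) (simp_all add: funpow_Suc_right del: funpow.simps)
      moreover have "(f ^^ n) ((f ^^ i) x) = (f ^^ i) ((f ^^ n) x)"
        by (metis add.commute comp_apply funpow_add)
      ultimately show ?thesis using x(3) by simp
    qed
    have "f p = f q" unfolding f_def pq(3) ..
    then show "p = q" using shift[of i] shift[of j] ij by metis
  qed
  then have "distinct (map s ps)" using dist by (simp add: distinct_map)
  moreover have in_M: "set ps \<subseteq> set_mset M" using mem unfolding ps_def by auto
  moreover have "set (map s ps) \<subseteq> set_mset N"
    unfolding set_map using s in_M by (metis image_subsetI subsetD)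
  moreover have "ps \<noteq> []" unfolding ps_def using x(2) by simp
  ultimately show thesis using that[of ps] link dist cs mset_subset_if_distinct by metis
qed

text \<open>A cycle splits off from \<open>M\<close> and its corners from \<open>N\<close>. These
  are congruent, hence of equal degrees, so the smaller remainders have equal degrees again.\<close>

lemma same_degrees_bcong:
  assumes P: "finite P" "simple P"
  shows "same_degrees P M N \<Longrightarrow> bcong (rect_moves P) M N"
proof (induction "size M" arbitrary: M N rule: less_induct)
  case less
  show ?case
  proof (cases "M = {#}")
    case True
    have "N = {#}"
    proof (rule ccontr)
      assume "N \<noteq> {#}"
      then obtain q where "q \<in># N" by blast
      then have "q \<in># filter_mset (hlink P q) N" by simp
      then show False using less(2) True unfolding same_degrees_def
        by (metis filter_empty_mset size_empty size_eq_0_iff_empty empty_iff set_mset_empty)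
    qed
    then show ?thesis using True by simp
  next
    case False
    then obtain ps where ps: "ps \<noteq> []" "successively (elink P) (ps @ [hd ps])" "mset ps \<subseteq># M"
      "mset (corners (ps @ [hd ps])) \<subseteq># N" using obtain_common_cycle[OF less(2)] by blast
    define C where "C = mset ps"
    define D where "D = mset (corners (ps @ [hd ps]))"
    have CD: "bcong (rect_moves P) C D" unfolding C_def D_def using cycle_bcong[OF P] ps by blast
    obtain M' N' where MN: "M = C + M'" "N = D + N'"
      using ps(3,4) unfolding C_def D_def by (meson mset_subset_eq_exists_conv)
    have "same_degrees P (D + M') (C + M')"
      using bcong_same_degrees[OF CD] same_degrees_add[of P M'] same_degrees_sym
      by (metis add.commute)
    then have "same_degrees P (D + M') (D + N')"
      using less(2) same_degrees_trans unfolding MN by blast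
    then have "same_degrees P M' N'" by (simp add: same_degrees_add)
    moreover have "size M' < size M" using ps(1) unfolding MN C_def by simp
    ultimately have "bcong (rect_moves P) M' N'" using less(1) by blast
    then show ?thesis unfolding MN by (rule bcong_add2[OF CD])
  qed
qed

lemma rect_moves_cancel:
  assumes "finite P" "simple P" "bcong (rect_moves P) (U + M) (U + N)"
  shows "bcong (rect_moves P) M N"
  using same_degrees_bcong[OF assms(1,2)] bcong_same_degrees[OF assms(3)]
  by (simp add: same_degrees_add)

section \<open>Components\<close>

lemma rtranclp_walk:
  assumes "r\<^sup>*\<^sup>* a b"
  obtains xs where "xs \<noteq> []" "hd xs = a" "last xs = b" "successively r xs"
proof -
  have "\<exists>xs. xs \<noteq> [] \<and> hd xs = a \<and> last xs = b \<and> successively r xs"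
    using assms
  proof (induction rule: rtranclp_induct)
    case base
    show ?case by (intro exI[of _ "[a]"]) simp
  next
    case (step b c)
    then obtain xs where "xs \<noteq> []" "hd xs = a" "last xs = b" "successively r xs" by blast
    then show ?case using step(2)
      by (intro exI[of _ "xs @ [c]"]) (simp add: successively_append_iff)
  qed
  then show thesis using that by blast
qed

lemma wpar_append: "wpar f (xs @ p # ys) = (wpar f (xs @ [p]) \<noteq> wpar f (p # ys))"
  by (induction xs rule: induct_list012) auto

text \<open>Unlike \<open>elink\<close>, this remembers one cell of \<open>A\<close> containing the
  step, which allows a local case analysis around a shared vertex.\<close>

definition estep :: "pt set set \<Rightarrow> pt \<Rightarrow> pt \<Rightarrow> bool" where
  "estep A p q \<longleftrightarrow> (\<exists>x y. cell x y \<in> A \<and> p \<in> cell x y \<and> q \<in> cell x y \<and>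
     (fst p = fst q \<or> snd p = snd q))"

lemma estep_elink:
  assumes "estep A p q" "A \<subseteq> P"
  shows "elink P p q"
proof -
  obtain x y where c: "cell x y \<in> P" "p \<in> cell x y" "q \<in> cell x y" "fst p = fst q \<or> snd p = snd q"
    using assms unfolding estep_def by blast
  have b: "x \<le> fst p" "fst p \<le> x + 1" "y \<le> snd p" "snd p \<le> y + 1"
    "x \<le> fst q" "fst q \<le> x + 1" "y \<le> snd q" "snd q \<le> y + 1" using c unfolding mem_cell by auto
  have "vedge P (fst p) t" if "min (snd p) (snd q) \<le> t" "t < max (snd p) (snd q)" for t
  proof -
    have "t = y" using that b by linarith
    moreover have "fst p = x \<or> fst p = x + 1" using b by linarith
    ultimately show ?thesis using c(1) unfolding vedge_def by auto
  qed
  moreover have "hedge P t (snd q)" if "min (fst p) (fst q) \<le> t" "t < max (fst p) (fst q)" for t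
  proof -
    have "t = x" using that b by linarith
    moreover have "snd q = y \<or> snd q = y + 1" using b by linarith
    ultimately show ?thesis using c(1) unfolding hedge_def by auto
  qed
  ultimately show ?thesis unfolding elink_def vlink_def hlink_def by simp
qed

lemma estep_connected:
  assumes A: "\<forall>C\<in>A. is_cell C" "weakly_connected A" and pq: "p \<in> vertices A" "q \<in> vertices A"
  shows "(estep A)\<^sup>*\<^sup>* p q"
proof -
  have in_cell: "(estep A)\<^sup>*\<^sup>* p q" if C: "C \<in> A" "p \<in> C" "q \<in> C" for C p q
  proof -
    obtain x y where cell: "C = cell x y" using A(1) C(1) unfolding is_cell_iff by auto
    have "(fst p, snd q) \<in> cell x y" using C unfolding cell mem_cell by auto
    then have "estep A p (fst p, snd q)" "estep A (fst p, snd q) q"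
      using C unfolding cell estep_def by auto
    then show ?thesis by simp
  qed
  obtain C D where CD: "C \<in> A" "p \<in> C" "D \<in> A" "q \<in> D" using pq unfolding vertices_def by auto
  have "(\<lambda>X Y. X \<in> A \<and> Y \<in> A \<and> share_vertex X Y)\<^sup>*\<^sup>* C D"
    using A(2) CD unfolding weakly_connected_def by blast
  then have "D \<in> A \<and> (\<forall>q\<in>D. (estep A)\<^sup>*\<^sup>* p q)"
  proof (induction rule: rtranclp_induct)
    case base
    then show ?case using CD in_cell by blast
  next
    case (step D E)
    then obtain z where "z \<in> D" "z \<in> E" unfolding share_vertex_def by blast
    then show ?case using step in_cell rtranclp_trans by metis
  qed
  then show ?thesis using CD by blast
qed

text \<open>Go from \<open>v\<close> to \<open>w\<close> in \<open>A\<close> and back in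
  \<open>B\<close>. The parities at the two empty cells differ by the coboundary of \<open>g\<close>
  on the way out and of \<open>g'\<close> on the way back. As \<open>g\<close> and \<open>g'\<close>
  agree at \<open>w\<close> but not at \<open>v\<close>, one of the parities is odd.\<close>

lemma parity_contradiction:
  assumes P: "finite P" "simple P" and cells: "\<forall>C\<in>P. is_cell C"
    and A: "A \<subseteq> P" "weakly_connected A" and B: "B \<subseteq> P" "weakly_connected B"
    and v: "v \<in> vertices A" "v \<in> vertices B" and w: "w \<in> vertices A" "w \<in> vertices B"
    and out: "cell c r \<notin> P" "cell c' r' \<notin> P"
    and stepA: "\<And>p q. estep A p q \<Longrightarrow> crosses c r p q = (crosses c' r' p q \<noteq> (g p \<noteq> g q))"
    and stepB: "\<And>p q. estep B p q \<Longrightarrow> crosses c r p q = (crosses c' r' p q \<noteq> (g' p \<noteq> g' q))"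
    and g: "g' v = (\<not> g v)" "g' w = g w"
  shows False
proof -
  have "(estep A)\<^sup>*\<^sup>* v w" using estep_connected[of A v w] A cells v w by blast
  then obtain xs where xs: "xs \<noteq> []" "hd xs = v" "last xs = w" "successively (estep A) xs"
    by (rule rtranclp_walk)
  have "(estep B)\<^sup>*\<^sup>* w v" using estep_connected[of B w v] B cells v w by blast
  then obtain ys where ys: "ys \<noteq> []" "hd ys = w" "last ys = v" "successively (estep B) ys"
    by (rule rtranclp_walk)
  define zs where "zs = xs @ tl ys"
  have walk: "xs = butlast xs @ [w]" "ys = w # tl ys"
    using xs ys by (metis append_butlast_last_id) (use ys in \<open>metis list.collapse\<close>)
  have zs: "zs = butlast xs @ w # tl ys"
    unfolding zs_def using walk(1) by (metis append.assoc append_Cons append_Nil)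
  have par: "wpar f zs = (wpar f xs \<noteq> wpar f ys)" for f
    unfolding zs using wpar_append[of f "butlast xs" w "tl ys"] walk by metis
  have "successively (elink P) xs" "successively (elink P) ys"
    using xs(4) ys(4) estep_elink A(1) B(1) by (blast intro: successively_mono)+
  then have "successively (elink P) xs" "successively (elink P) (w # tl ys)"
    using walk(2) by metis+
  then have "successively (elink P) zs"
    using xs(3) unfolding zs_def by (auto simp: successively_append_iff successively_Cons)
  moreover have "hd zs = v" "last zs = v" "zs \<noteq> []"
    using xs ys walk unfolding zs_def by (auto simp: last_append) (metis last_ConsL last_ConsR)+
  ultimately have "closed_walk P zs" unfolding closed_walk_def by simp
  then have "\<not> wpar (crosses c r) zs" "\<not> wpar (crosses c' r') zs"
    using wpar_crosses_outside[OF P] out by blast+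
  moreover have "wpar (crosses c r) xs = (wpar (crosses c' r') xs \<noteq> (g v \<noteq> g w))"
    using wpar_coboundary[OF stepA xs(4,1)] xs by simp
  moreover have "wpar (crosses c r) ys = (wpar (crosses c' r') ys \<noteq> (g' w \<noteq> g' v))"
    using wpar_coboundary[OF stepB ys(4,1)] ys by simp
  ultimately show False unfolding par using g by auto
qed

lemma shared_vertex_unique_upper:
  assumes P: "finite P" "simple P" and cells: "\<forall>C\<in>P. is_cell C"
    and A: "A \<subseteq> P" "weakly_connected A" and B: "B \<subseteq> P" "weakly_connected B"
    and v: "(a, b) \<in> vertices A" "(a, b) \<in> vertices B"
    and w: "w \<in> vertices A" "w \<in> vertices B" "w \<noteq> (a, b)"
  shows "\<not> (cell (a - 1) (b - 1) \<in> A - B \<and> cell a b \<in> B - A \<and>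
      cell (a - 1) b \<notin> P \<and> cell a (b - 1) \<notin> P)"
    and "\<not> (cell a (b - 1) \<in> A - B \<and> cell (a - 1) b \<in> B - A \<and>
      cell a b \<notin> P \<and> cell (a - 1) (b - 1) \<notin> P)"
proof -
  \<comment> \<open>Both mark the vertical half-line above \<open>(a, b)\<close>, across which the
    ray is moved. The point \<open>(a, b)\<close> itself must not count for \<open>A\<close>, which
    holds the lower of the two cells there, and must count for \<open>B\<close>, which holds the
    upper one.\<close>
  define g g' where "g p = (fst p = a \<and> b < snd p)" and "g' p = (fst p = a \<and> b \<le> snd p)"
    for p :: pt
  have gv: "g' (a, b) = (\<not> g (a, b))" and gw: "g' w = g w"
    using w(3) unfolding g_def g'_def by (auto simp: prod_eq_iff)
  have stepA: "crosses (a - 1) b p q = (crosses a (b - 1) p q \<noteq> (g p \<noteq> g q))"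
    if st: "estep D p q" "cell a b \<notin> D" "cell (a - 1) b \<notin> D" "cell a (b - 1) \<notin> D" for p q D
  proof -
    obtain x y where c: "cell x y \<in> D" "p \<in> cell x y" "q \<in> cell x y" "fst p = fst q \<or> snd p = snd q"
      using st(1) unfolding estep_def by blast
    then have "\<not> (x = a \<and> y = b)" "\<not> (x = a - 1 \<and> y = b)" "\<not> (x = a \<and> y = b - 1)"
      using st by auto
    then show ?thesis using c(2-) unfolding mem_cell crosses_def g_def by smt
  qed
  have stepB: "crosses (a - 1) b p q = (crosses a (b - 1) p q \<noteq> (g' p \<noteq> g' q))"
    if st: "estep D p q" "cell (a - 1) (b - 1) \<notin> D" "cell (a - 1) b \<notin> D" "cell a (b - 1) \<notin> D" for p q D
  proof -
    obtain x y where c: "cell x y \<in> D" "p \<in> cell x y" "q \<in> cell x y" "fst p = fst q \<or> snd p = snd q"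
      using st(1) unfolding estep_def by blast
    then have "\<not> (x = a - 1 \<and> y = b - 1)" "\<not> (x = a - 1 \<and> y = b)" "\<not> (x = a \<and> y = b - 1)"
      using st by auto
    then show ?thesis using c(2-) unfolding mem_cell crosses_def g'_def by smt
  qed
  have stepA': "crosses a b p q = (crosses (a - 1) (b - 1) p q \<noteq> (g p \<noteq> g q))"
    if st: "estep D p q" "cell a b \<notin> D" "cell (a - 1) b \<notin> D" "cell (a - 1) (b - 1) \<notin> D" for p q D
  proof -
    obtain x y where c: "cell x y \<in> D" "p \<in> cell x y" "q \<in> cell x y" "fst p = fst q \<or> snd p = snd q"
      using st(1) unfolding estep_def by blast
    then have "\<not> (x = a \<and> y = b)" "\<not> (x = a - 1 \<and> y = b)" "\<not> (x = a - 1 \<and> y = b - 1)"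
      using st by auto
    then show ?thesis using c(2-) unfolding mem_cell crosses_def g_def by smt
  qed
  have stepB': "crosses a b p q = (crosses (a - 1) (b - 1) p q \<noteq> (g' p \<noteq> g' q))"
    if st: "estep D p q" "cell (a - 1) (b - 1) \<notin> D" "cell a b \<notin> D" "cell a (b - 1) \<notin> D" for p q D
  proof -
    obtain x y where c: "cell x y \<in> D" "p \<in> cell x y" "q \<in> cell x y" "fst p = fst q \<or> snd p = snd q"
      using st(1) unfolding estep_def by blast
    then have "\<not> (x = a - 1 \<and> y = b - 1)" "\<not> (x = a \<and> y = b)" "\<not> (x = a \<and> y = b - 1)"
      using st by auto
    then show ?thesis using c(2-) unfolding mem_cell crosses_def g'_def by smt
  qed
  show "\<not> (cell (a - 1) (b - 1) \<in> A - B \<and> cell a b \<in> B - A \<and>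
      cell (a - 1) b \<notin> P \<and> cell a (b - 1) \<notin> P)"
  proof
    assume "cell (a - 1) (b - 1) \<in> A - B \<and> cell a b \<in> B - A \<and>
      cell (a - 1) b \<notin> P \<and> cell a (b - 1) \<notin> P"
    then show False
      using A(1) B(1)
      by (intro parity_contradiction[OF P cells A B v w(1,2) _ _ _ _ gv gw, of "a - 1" b a "b - 1"]
          stepA[of A] stepB[of B]) auto
  qed
  show "\<not> (cell a (b - 1) \<in> A - B \<and> cell (a - 1) b \<in> B - A \<and>
      cell a b \<notin> P \<and> cell (a - 1) (b - 1) \<notin> P)"
  proof
    assume "cell a (b - 1) \<in> A - B \<and> cell (a - 1) b \<in> B - A \<and>
      cell a b \<notin> P \<and> cell (a - 1) (b - 1) \<notin> P"
    then show False
      using A(1) B(1)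
      by (intro parity_contradiction[OF P cells A B v w(1,2) _ _ _ _ gv gw, of a b "a - 1" "b - 1"]
          stepA'[of A] stepB'[of B]) auto
  qed
qed

text \<open>Two edge-closed connected parts of a simple collection meet in at most one vertex: a walk
  through both of them and a second common vertex would separate the two empty cells at the first.\<close>

lemma shared_vertex_unique:
  assumes P: "finite P" "simple P" and cells: "\<forall>C\<in>P. is_cell C"
    and A: "A \<subseteq> P" "weakly_connected A" and B: "B \<subseteq> P" "weakly_connected B"
    and disj: "A \<inter> B = {}"
    and closedA: "\<And>C D. C \<in> A \<Longrightarrow> D \<in> P \<Longrightarrow> share_edge C D \<Longrightarrow> D \<in> A"
    and closedB: "\<And>C D. C \<in> B \<Longrightarrow> D \<in> P \<Longrightarrow> share_edge C D \<Longrightarrow> D \<in> B"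
    and v: "v \<in> vertices A" "v \<in> vertices B" and w: "w \<in> vertices A" "w \<in> vertices B"
  shows "w = v"
proof (rule ccontr)
  assume ne: "w \<noteq> v"
  obtain a b where ab: "v = (a, b)" by force
  let ?S = "{cell (a - 1) (b - 1), cell a (b - 1), cell (a - 1) b, cell a b}"
  have at_v: "C \<in> ?S" if C': "is_cell C" "v \<in> C" for C
  proof -
    obtain x y where C: "C = cell x y" using C'(1) unfolding is_cell_iff by auto
    then have "(x = a - 1 \<or> x = a) \<and> (y = b - 1 \<or> y = b)" using C'(2) unfolding C ab mem_cell by auto
    then show ?thesis unfolding C by auto
  qed
  obtain C D where CD: "C \<in> A" "v \<in> C" "D \<in> B" "v \<in> D" using v unfolding vertices_def by auto
  then have S: "C \<in> ?S" "D \<in> ?S" using at_v cells A(1) B(1) by (meson subsetD)+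
  have e: "share_edge (cell (a - 1) y) (cell a y)" "share_edge (cell x (b - 1)) (cell x b)" for x y
    using share_edge_right[of "a - 1" y] share_edge_up[of x "b - 1"] by simp_all
  note e' = e e[THEN share_edge_sym]
  have no: False if "C \<in> A" "D \<in> B" "share_edge C D" for C D
    using closedA that B(1) disj by blast
  have none: "E \<notin> P" if "share_edge C E" "share_edge D E" for E
    using closedA[OF CD(1)] closedB[OF CD(3)] that disj by blast
  have "C \<noteq> D" using CD disj by blast
  moreover have "\<not> share_edge C D" using no CD by blast
  \<comment> \<open>Cells of \<open>A\<close> and \<open>B\<close> at \<open>v\<close> share no
    edge, so they are diagonally opposite; the other two cells at \<open>v\<close> border both and
    are empty by \<open>none\<close>.\<close>
  ultimately consider
      "C = cell (a - 1) (b - 1)" "D = cell a b" | "C = cell a b" "D = cell (a - 1) (b - 1)"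
    | "C = cell a (b - 1)" "D = cell (a - 1) b" | "C = cell (a - 1) b" "D = cell a (b - 1)"
    using S e' by auto
  then show False
  proof cases
    case 1
    then show False using shared_vertex_unique_upper(1)[OF P cells A B v[unfolded ab] w ne[unfolded ab]]
      none[of "cell (a - 1) b"] none[of "cell a (b - 1)"] e' CD disj by auto
  next
    case 2
    then show False
      using shared_vertex_unique_upper(1)[OF P cells B A v(2,1)[unfolded ab] w(2,1) ne[unfolded ab]]
      none[of "cell (a - 1) b"] none[of "cell a (b - 1)"] e' CD disj by auto
  next
    case 3
    then show False using shared_vertex_unique_upper(2)[OF P cells A B v[unfolded ab] w ne[unfolded ab]]
      none[of "cell a b"] none[of "cell (a - 1) (b - 1)"] e' CD disj by auto
  next
    case 4
    then show False
      using shared_vertex_unique_upper(2)[OF P cells B A v(2,1)[unfolded ab] w(2,1) ne[unfolded ab]]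
      none[of "cell a b"] none[of "cell (a - 1) (b - 1)"] e' CD disj by auto
  qed
qed

section \<open>Components as classes of edge-reachability\<close>

definition eadj :: "pt set set \<Rightarrow> pt set \<Rightarrow> pt set \<Rightarrow> bool" where
  "eadj P C D \<longleftrightarrow> C \<in> P \<and> D \<in> P \<and> share_edge C D"

lemma eadj_sym: "(eadj P)\<^sup>*\<^sup>* C D \<Longrightarrow> (eadj P)\<^sup>*\<^sup>* D C"
proof -
  have "symp (eadj P)" using share_edge_sym unfolding eadj_def by (auto intro!: sympI)
  then show "(eadj P)\<^sup>*\<^sup>* C D \<Longrightarrow> (eadj P)\<^sup>*\<^sup>* D C" by (rule symp_rtranclp[THEN sympD])
qed

lemma eadj_mono: "Q \<subseteq> P \<Longrightarrow> (eadj Q)\<^sup>*\<^sup>* C D \<Longrightarrow> (eadj P)\<^sup>*\<^sup>* C D"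
  by (rule rtranclp_mono[THEN predicate2D, of "eadj Q"]) (auto simp: eadj_def)

lemma edge_connected_eadj: "edge_connected P \<longleftrightarrow> (\<forall>C\<in>P. \<forall>D\<in>P. (eadj P)\<^sup>*\<^sup>* C D)"
  unfolding edge_connected_def eadj_def ..

lemma edge_imp_weakly_connected:
  assumes "edge_connected P"
  shows "weakly_connected P"
proof -
  have "share_vertex C D" if "share_edge C D" for C D
    using that unfolding share_edge_def share_vertex_def by auto
  then have "eadj P \<le> (\<lambda>X Y. X \<in> P \<and> Y \<in> P \<and> share_vertex X Y)"
    unfolding eadj_def by auto
  from rtranclp_mono[OF this] show ?thesis
    using assms unfolding edge_connected_eadj weakly_connected_def by blast
qed

definition edge_class :: "pt set set \<Rightarrow> pt set \<Rightarrow> pt set set" where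
  "edge_class P C = {D. (eadj P)\<^sup>*\<^sup>* C D}"

lemma edge_class_subset:
  assumes "C \<in> P"
  shows "edge_class P C \<subseteq> P"
proof
  fix D assume "D \<in> edge_class P C"
  then have "(eadj P)\<^sup>*\<^sup>* C D" unfolding edge_class_def by simp
  then show "D \<in> P" by cases (auto simp: assms eadj_def)
qed

lemma edge_class_eq:
  assumes "D \<in> edge_class P C"
  shows "edge_class P D = edge_class P C"
proof -
  have CD: "(eadj P)\<^sup>*\<^sup>* C D" using assms unfolding edge_class_def by simp
  show ?thesis unfolding edge_class_def
    using rtranclp_trans[OF CD] rtranclp_trans[OF eadj_sym[OF CD]] by auto
qed

lemma polyomino_edge_class:
  assumes "finite P" "\<forall>C\<in>P. is_cell C" "C \<in> P"
  shows "polyomino (edge_class P C)"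
proof -
  let ?Q = "edge_class P C"
  have C: "C \<in> ?Q" unfolding edge_class_def by simp
  have "(eadj ?Q)\<^sup>*\<^sup>* D E" if D: "D \<in> ?Q" and "(eadj P)\<^sup>*\<^sup>* D E" for D E
    using that(2)
  proof (induction rule: rtranclp_induct)
    case (step E F)
    have "E \<in> ?Q" "F \<in> ?Q" using D step(1,2) unfolding edge_class_def by auto
    then have "eadj ?Q E F" using step(2) unfolding eadj_def by simp
    then show ?case using step.IH by simp
  qed simp
  moreover have "(eadj P)\<^sup>*\<^sup>* D E" if "D \<in> ?Q" "E \<in> ?Q" for D E
    using that eadj_sym rtranclp_trans unfolding edge_class_def by (metis mem_Collect_eq)
  ultimately have "edge_connected ?Q" unfolding edge_connected_eadj by blast
  then show ?thesis
    unfolding polyomino_def collection_of_cells_def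
    using edge_imp_weakly_connected edge_class_subset[OF assms(3)] assms(1,2) C finite_subset by blast
qed

lemma polyomino_subset_edge_class:
  assumes "polyomino Q" "Q \<subseteq> P" "C \<in> Q"
  shows "Q \<subseteq> edge_class P C"
proof
  fix D assume "D \<in> Q"
  then have "(eadj Q)\<^sup>*\<^sup>* C D" using assms(1,3) unfolding polyomino_def edge_connected_eadj by simp
  then show "D \<in> edge_class P C" using eadj_mono[OF assms(2)] unfolding edge_class_def by simp
qed

text \<open>A polyomino in \<open>P\<close> lies in the reachability class of each of its cells, and
  these classes are polyominoes, so they are exactly the maximal ones.\<close>

lemma components_eq:
  assumes "finite P" "\<forall>C\<in>P. is_cell C"
  shows "components P = edge_class P ` P"
proof (intro equalityI subsetI)
  fix Q assume "Q \<in> components P"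
  then have Q: "Q \<subseteq> P" "polyomino Q" "\<And>Q'. Q \<subseteq> Q' \<Longrightarrow> Q' \<subseteq> P \<Longrightarrow> polyomino Q' \<Longrightarrow> Q' = Q"
    unfolding components_def by auto
  then obtain C where C: "C \<in> Q" unfolding polyomino_def collection_of_cells_def by blast
  then have "C \<in> P" using Q by blast
  then have "edge_class P C = Q"
    using Q C polyomino_subset_edge_class polyomino_edge_class[OF assms] edge_class_subset by metis
  then show "Q \<in> edge_class P ` P" using \<open>C \<in> P\<close> by blast
next
  fix Q assume "Q \<in> edge_class P ` P"
  then obtain C where C: "C \<in> P" "Q = edge_class P C" by blast
  have "C \<in> Q" unfolding C edge_class_def by simp
  then show "Q \<in> components P"
    unfolding components_def
    using C polyomino_edge_class[OF assms] edge_class_subset polyomino_subset_edge_class by blast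
qed

locale simple_collection =
  fixes P :: "pt set set"
  assumes fin: "finite P" and cells: "\<forall>C\<in>P. is_cell C" and simple: "simple P"
begin

lemma component_polyomino: "Q \<in> components P \<Longrightarrow> polyomino Q"
  unfolding components_def by blast

lemma component_subset: "Q \<in> components P \<Longrightarrow> Q \<subseteq> P"
  unfolding components_def by blast

lemma Union_components: "\<Union>(components P) = P"
proof -
  have "C \<in> edge_class P C" for C unfolding edge_class_def by simp
  then show ?thesis unfolding components_eq[OF fin cells] using edge_class_subset by blast
qed

lemma component_eq_edge_class: "Q \<in> components P \<Longrightarrow> C \<in> Q \<Longrightarrow> Q = edge_class P C"
  unfolding components_eq[OF fin cells] by (auto dest: edge_class_eq)

lemma components_unique:
  "Q \<in> components P \<Longrightarrow> R \<in> components P \<Longrightarrow> C \<in> Q \<Longrightarrow> C \<in> R \<Longrightarrow> Q = R"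
  using component_eq_edge_class by blast

lemma component_closed:
  assumes "Q \<in> components P" "C \<in> Q" "D \<in> P" "share_edge C D"
  shows "D \<in> Q"
  using component_eq_edge_class[OF assms(1,2)] component_subset[OF assms(1)] assms(2-)
  unfolding edge_class_def eadj_def by auto

text \<open>From the lower left cell every cell of the interval is reached along the bottom row and
  then up a column, so an inner interval never spreads over two components.\<close>

lemma inner_interval_component:
  assumes ab: "inner_interval P a b"
  obtains Q where "Q \<in> components P" "inner_interval Q a b" "cell (fst a) (snd a) \<in> Q"
proof -
  let ?C = "cell (fst a) (snd a)"
  have ab': "fst a < fst b" "snd a < snd b"
    "\<And>x y. fst a \<le> x \<Longrightarrow> x < fst b \<Longrightarrow> snd a \<le> y \<Longrightarrow> y < snd b \<Longrightarrow> cell x y \<in> P"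
    using ab unfolding inner_interval_iff by auto
  have row: "x < fst b \<Longrightarrow> (eadj P)\<^sup>*\<^sup>* ?C (cell x (snd a))" if "fst a \<le> x" for x
    using that
  proof (induction x rule: int_ge_induct)
    case (step x)
    then have "eadj P (cell x (snd a)) (cell (x + 1) (snd a))"
      using ab' share_edge_right unfolding eadj_def by simp
    then show ?case using step by (simp add: rtranclp.rtrancl_into_rtrancl)
  qed simp
  have "y < snd b \<Longrightarrow> (eadj P)\<^sup>*\<^sup>* ?C (cell x y)" if "fst a \<le> x" "x < fst b" "snd a \<le> y" for x y
    using that(3)
  proof (induction y rule: int_ge_induct)
    case base
    then show ?case using row that by simp
  next
    case (step y)
    then have "eadj P (cell x y) (cell x (y + 1))"
      using ab' share_edge_up that unfolding eadj_def by simp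
    then show ?case using step by (simp add: rtranclp.rtrancl_into_rtrancl)
  qed
  then have "inner_interval (edge_class P ?C) a b"
    using ab'(1,2) unfolding inner_interval_iff edge_class_def by simp
  moreover have "edge_class P ?C \<in> components P"
    unfolding components_eq[OF fin cells] using ab' by simp
  moreover have "?C \<in> edge_class P ?C" unfolding edge_class_def by simp
  ultimately show thesis using that by blast
qed

lemma shared_vertex_union_unique:
  assumes \<A>: "\<A> \<subseteq> components P" "weakly_connected (\<Union>\<A>)" and Q: "Q \<in> components P" "Q \<notin> \<A>"
    and "v \<in> vertices Q" "v \<in> vertices (\<Union>\<A>)" "w \<in> vertices Q" "w \<in> vertices (\<Union>\<A>)"
  shows "w = v"
proof (rule shared_vertex_unique[OF fin simple cells, of Q "\<Union>\<A>"])
  show "Q \<subseteq> P" "\<Union>\<A> \<subseteq> P" using Q \<A> component_subset by blast+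
  show "weakly_connected Q"
    using component_polyomino[OF Q(1)] unfolding polyomino_def collection_of_cells_def by blast
  show "Q \<inter> \<Union>\<A> = {}" using Q \<A>(1) components_unique by blast
  show "\<And>C D. C \<in> Q \<Longrightarrow> D \<in> P \<Longrightarrow> share_edge C D \<Longrightarrow> D \<in> Q" using component_closed[OF Q(1)] .
  show "\<And>C D. C \<in> \<Union>\<A> \<Longrightarrow> D \<in> P \<Longrightarrow> share_edge C D \<Longrightarrow> D \<in> \<Union>\<A>"
    using component_closed \<A>(1) by blast
qed (use assms in auto)

text \<open>A move of another component applied to a monomial in the vertices of \<open>Q\<close>
  would have two points of different abscissa in common with \<open>Q\<close>, against the
  uniqueness of the shared vertex.\<close>

lemma bcong_restrict_component:
  assumes Q: "Q \<in> components P" and "bcong (rect_moves P) M N" "set_mset M \<subseteq> vertices Q"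
  shows "bcong (rect_moves Q) M N"
  using assms(2)
proof (induction rule: rtranclp_induct)
  case (step N N')
  have N: "set_mset N \<subseteq> vertices Q"
    using bcong_graded[OF graded_on_rect_moves step.IH] assms(3) by blast
  obtain U x y where U: "(x, y) \<in> rect_moves P \<or> (y, x) \<in> rect_moves P" "N = U + x" "N' = U + y"
    using step(2) unfolding bstep_def by blast
  then obtain a b where ab: "inner_interval P a b"
    "x = {#a, b#} \<and> y = {#(fst a, snd b), (fst b, snd a)#} \<or>
     y = {#a, b#} \<and> x = {#(fst a, snd b), (fst b, snd a)#}" unfolding rect_moves_def by blast
  obtain R where R: "R \<in> components P" "inner_interval R a b"
    using inner_interval_component[OF ab(1)] by blast
  have "R = Q"
  proof (rule ccontr)
    assume "R \<noteq> Q"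
    have wc: "weakly_connected (\<Union>{R})"
      using component_polyomino[OF R(1)] unfolding polyomino_def collection_of_cells_def by simp
    have uniq: "w = v" if "v \<in> vertices Q" "v \<in> vertices R" "w \<in> vertices Q" "w \<in> vertices R" for v w
      using shared_vertex_union_unique[OF _ wc Q] that R(1) \<open>R \<noteq> Q\<close> by simp
    have "fst a \<noteq> fst b" using ab(1) unfolding inner_interval_iff by simp
    moreover have "set_mset x \<subseteq> vertices Q" using N U(2) by simp
    ultimately show False using ab(2) uniq inner_interval_corners[OF R(2)]
      by (metis fst_conv insert_subset set_mset_add_mset_insert)
  qed
  then have "(x, y) \<in> rect_moves Q \<or> (y, x) \<in> rect_moves Q"
    using ab(2) R(2) unfolding rect_moves_def by blast
  then have "bstep (rect_moves Q) N N'" unfolding bstep_def using U(2,3) by blast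
  then show ?case using step.IH by simp
qed simp

lemma rect_moves_mono: "Q \<subseteq> R \<Longrightarrow> rect_moves Q \<subseteq> rect_moves R"
  unfolding rect_moves_def inner_interval_def by blast

text \<open>Simplicity is given for \<open>P\<close>, so the congruence is lifted to
  \<open>P\<close>, cancelled there and restricted to \<open>Q\<close> again.\<close>

lemma free_variable_component:
  assumes "Q \<in> components P" "v \<in> vertices Q"
  shows "free_variable (vertices Q) (rect_moves Q) v"
proof
  show "finite (vertices Q)"
    using component_subset[OF assms(1)] fin cells by (intro finite_vertices) (auto intro: finite_subset)
  show "graded_on (vertices Q) (rect_moves Q)" by (rule graded_on_rect_moves)
  show "v \<in> vertices Q" by (rule assms(2))
  fix M N :: "pt multiset"
  assume M: "set_mset M \<subseteq> vertices Q" and "bcong (rect_moves Q) (add_mset v M) (add_mset v N)"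
  then have "bcong (rect_moves P) ({#v#} + M) ({#v#} + N)"
    using bcong_mono[OF rect_moves_mono[OF component_subset[OF assms(1)]]] by simp
  then have "bcong (rect_moves P) M N" by (rule rect_moves_cancel[OF fin simple])
  then show "bcong (rect_moves Q) M N" using bcong_restrict_component assms(1) M by blast
qed

section \<open>Hilbert series of unions of components\<close>

abbreviation series :: "pt set set \<Rightarrow> int fps" where
  "series Q \<equiv> class_series (vertices Q) (rect_moves Q)"

lemma series_insert:
  assumes \<A>: "\<A> \<subseteq> components P" "weakly_connected (\<Union>\<A>)" and Q: "Q \<in> components P" "Q \<notin> \<A>"
    and shared: "v \<in> vertices Q" "v \<in> vertices (\<Union>\<A>)"
  shows "series (\<Union>(insert Q \<A>)) = series Q * series (\<Union>\<A>) * (1 - fps_X)"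
proof -
  note finite_P = fin
  interpret free_variable "vertices Q" "rect_moves Q" v
    by (rule free_variable_component[OF Q(1) shared(1)])
  interpret glued "vertices Q" "rect_moves Q" v "vertices (\<Union>\<A>)" "rect_moves (\<Union>\<A>)"
  proof
    have "\<Union>\<A> \<subseteq> P" using \<A>(1) component_subset by blast
    then show "finite (vertices (\<Union>\<A>))"
      using finite_P cells by (intro finite_vertices) (auto intro: finite_subset)
    show "graded_on (vertices (\<Union>\<A>)) (rect_moves (\<Union>\<A>))" by (rule graded_on_rect_moves)
    show "vertices Q \<inter> vertices (\<Union>\<A>) = {v}"
      using shared_vertex_union_unique[OF \<A> Q shared] shared by blast
  qed
  \<comment> \<open>An inner interval of the union lies in a single component, identified by its
    lower left cell, so gluing creates no new moves.\<close>
  have "rect_moves (\<Union>(insert Q \<A>)) \<subseteq> rect_moves Q \<union> rect_moves (\<Union>\<A>)"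
  proof
    fix m assume "m \<in> rect_moves (\<Union>(insert Q \<A>))"
    then obtain a b where ab: "inner_interval (\<Union>(insert Q \<A>)) a b"
      "m = ({#a, b#}, {#(fst a, snd b), (fst b, snd a)#})" unfolding rect_moves_def by blast
    have "\<Union>(insert Q \<A>) \<subseteq> P" using \<A>(1) Q(1) component_subset by blast
    then have "inner_interval P a b" using ab(1) unfolding inner_interval_def by blast
    then obtain R where R: "R \<in> components P" "inner_interval R a b" "cell (fst a) (snd a) \<in> R"
      by (rule inner_interval_component)
    have "cell (fst a) (snd a) \<in> \<Union>(insert Q \<A>)" using ab(1) unfolding inner_interval_iff by auto
    then have "R \<in> insert Q \<A>" using R components_unique \<A>(1) Q(1) by blast
    moreover have "m \<in> rect_moves R" using R(2) ab(2) unfolding rect_moves_def by blast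
    ultimately show "m \<in> rect_moves Q \<union> rect_moves (\<Union>\<A>)"
      using rect_moves_mono[of R "\<Union>\<A>"] by blast
  qed
  moreover have "rect_moves Q \<union> rect_moves (\<Union>\<A>) \<subseteq> rect_moves (\<Union>(insert Q \<A>))"
    using rect_moves_mono[of Q "\<Union>(insert Q \<A>)"] rect_moves_mono[of "\<Union>\<A>" "\<Union>(insert Q \<A>)"] by blast
  ultimately have "rect_moves (\<Union>(insert Q \<A>)) = rect_moves Q \<union> rect_moves (\<Union>\<A>)" by blast
  moreover have "vertices (\<Union>(insert Q \<A>)) = vertices Q \<union> vertices (\<Union>\<A>)"
    unfolding vertices_def by blast
  ultimately show ?thesis using class_series_glued by simp
qed

lemma weakly_connected_Un:
  assumes A: "weakly_connected A" and B: "weakly_connected B" and CD: "C \<in> A" "D \<in> B" "share_vertex C D"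
  shows "weakly_connected (A \<union> B)"
proof -
  define r where "r A = (\<lambda>X Y. X \<in> A \<and> Y \<in> A \<and> share_vertex X Y)" for A :: "pt set set"
  have mono: "(r S)\<^sup>*\<^sup>* E F \<Longrightarrow> (r (A \<union> B))\<^sup>*\<^sup>* E F" if "S \<subseteq> A \<union> B" for E F S
    by (rule rtranclp_mono[THEN predicate2D, of "r S"]) (use that in \<open>auto simp: r_def\<close>)
  have sym: "(r (A \<union> B))\<^sup>*\<^sup>* F E" if "(r (A \<union> B))\<^sup>*\<^sup>* E F" for E F
  proof -
    have "symp (r (A \<union> B))" unfolding r_def share_vertex_def by (auto intro!: sympI)
    then show ?thesis using that by (meson sympD symp_rtranclp)
  qed
  have "(r (A \<union> B))\<^sup>*\<^sup>* C E" if "E \<in> A \<union> B" for E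
  proof (cases "E \<in> A")
    case True
    then show ?thesis using A CD(1) mono[of A] unfolding weakly_connected_def r_def[symmetric] by blast
  next
    case False
    then have "(r (A \<union> B))\<^sup>*\<^sup>* D E"
      using that B CD(2) mono[of B] unfolding weakly_connected_def r_def[symmetric] by blast
    moreover have "r (A \<union> B) C D" using CD unfolding r_def by simp
    ultimately show ?thesis by (simp add: converse_rtranclp_into_rtranclp)
  qed
  then show ?thesis unfolding weakly_connected_def r_def[symmetric] by (meson sym rtranclp_trans)
qed

text \<open>Components are added so that every partial union stays weakly connected, which is what
  limits its overlap with the next component to one vertex.\<close>

lemma series_partial_union:
  assumes conn: "weakly_connected P" and "m < card (components P)"
  shows "\<exists>\<A> \<subseteq> components P. card \<A> = Suc m \<and> weakly_connected (\<Union>\<A>) \<and>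
    series (\<Union>\<A>) = (1 - fps_X) ^ m * (\<Prod>Q\<in>\<A>. series Q)"
  using assms(2)
proof (induction m)
  case 0
  then obtain Q where Q: "Q \<in> components P" by fastforce
  then show ?case using component_polyomino[OF Q]
    unfolding polyomino_def collection_of_cells_def by (intro exI[of _ "{Q}"]) simp
next
  case (Suc m)
  then obtain \<A> where \<A>: "\<A> \<subseteq> components P" "card \<A> = Suc m" "weakly_connected (\<Union>\<A>)"
    "series (\<Union>\<A>) = (1 - fps_X) ^ m * (\<Prod>Q\<in>\<A>. series Q)" by auto
  have finA: "finite \<A>" using \<A>(2) by (metis card.infinite nat.distinct(1))
  have "\<A> \<noteq> {}" using \<A>(2) by auto
  then obtain Q0 C where C: "Q0 \<in> \<A>" "C \<in> Q0"
    using \<A>(1) component_polyomino unfolding polyomino_def collection_of_cells_def by blast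
  obtain Q1 where Q1: "Q1 \<in> components P" "Q1 \<notin> \<A>"
    using Suc(2) \<A>(1,2) by (metis less_irrefl subsetI subset_antisym)
  then obtain D where D: "D \<in> Q1"
    using component_polyomino unfolding polyomino_def collection_of_cells_def by blast
  have CD: "C \<in> P" "D \<in> P" using C D Q1 \<A>(1) component_subset by blast+
  have D': "D \<notin> \<Union>\<A>" using components_unique Q1 D \<A>(1) by blast
  have "(\<lambda>X Y. X \<in> P \<and> Y \<in> P \<and> share_vertex X Y)\<^sup>*\<^sup>* C D"
    using conn CD unfolding weakly_connected_def by blast
  \<comment> \<open>A chain leading out of the union leaves it at some pair of touching cells; the
    outer one determines the component to add.\<close>
  then have "D \<in> \<Union>\<A> \<or> (\<exists>X Y. X \<in> \<Union>\<A> \<and> Y \<in> P - \<Union>\<A> \<and> share_vertex X Y)"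
    by (induction rule: rtranclp_induct) (use C in blast)+
  then obtain E F where EF: "E \<in> \<Union>\<A>" "F \<in> P - \<Union>\<A>" "share_vertex E F" using D' by blast
  then obtain Q where Q: "Q \<in> components P" "F \<in> Q" using Union_components by blast
  then have Q': "Q \<notin> \<A>" using EF by blast
  obtain v where "v \<in> E" "v \<in> F" using EF(3) unfolding share_vertex_def by blast
  then have v: "v \<in> vertices Q" "v \<in> vertices (\<Union>\<A>)" using EF(1) Q(2) unfolding vertices_def by blast+
  have "weakly_connected Q"
    using component_polyomino[OF Q(1)] unfolding polyomino_def collection_of_cells_def by blast
  then have "weakly_connected (\<Union>\<A> \<union> Q)" using weakly_connected_Un \<A>(3) EF Q(2) by blast
  then have "weakly_connected (\<Union>(insert Q \<A>))" by (simp add: Un_commute)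
  moreover have "series (\<Union>(insert Q \<A>)) = (1 - fps_X) ^ Suc m * (\<Prod>Q\<in>insert Q \<A>. series Q)"
    using series_insert[OF \<A>(1,3) Q(1) Q' v] \<A>(4) finA Q' by (simp add: mult_ac)
  moreover have "card (insert Q \<A>) = Suc (Suc m)" using finA Q' \<A>(2) by simp
  ultimately show ?case using \<A>(1) Q(1) by (intro exI[of _ "insert Q \<A>"]) simp
qed

lemma finite_components: "finite (components P)"
  unfolding components_eq[OF fin cells] using fin by simp

text \<open>With a factor \<open>1 - fps_X\<close> attached to each series, gluing is plain
  multiplication: joining \<open>n\<close> components takes \<open>n - 1\<close> gluings.\<close>

lemma series_product:
  assumes conn: "weakly_connected P" and "P \<noteq> {}"
  shows "series P * (1 - fps_X) = (\<Prod>Q\<in>components P. series Q * (1 - fps_X))"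
proof -
  have "components P \<noteq> {}" using Union_components assms(2) by auto
  then have pos: "0 < card (components P)" using finite_components by (simp add: card_gt_0_iff)
  then obtain \<A> where \<A>: "\<A> \<subseteq> components P" "card \<A> = card (components P)"
    "series (\<Union>\<A>) = (1 - fps_X) ^ (card (components P) - 1) * (\<Prod>Q\<in>\<A>. series Q)"
    using series_partial_union[OF conn, of "card (components P) - 1"] by auto
  then have "\<A> = components P" using card_subset_eq[OF finite_components] by blast
  then have "series P = (1 - fps_X) ^ (card (components P) - 1) * (\<Prod>Q\<in>components P. series Q)"
    using \<A>(3) Union_components by simp
  then have "series P * (1 - fps_X) =
      (1 - fps_X) ^ Suc (card (components P) - 1) * (\<Prod>Q\<in>components P. series Q)"
    by (simp add: mult_ac)
  then show ?thesis using pos by (simp add: prod.distrib mult_ac)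
qed

end

lemma hilbert_series_eq_class_series:
  assumes "finite P" "\<forall>C\<in>P. is_cell C"
  shows "hilbert_series K P = class_series (vertices P) (rect_moves P)"
  unfolding hilbert_series_def class_series_def hilbert_fun_eq_class_count[OF assms] ..

text \<open>Powers of a single variable give a class in every degree, so no coefficient
  vanishes.\<close>

lemma hilbert_series_not_polynomial:
  assumes "collection_of_cells P"
  shows "hilbert_series K P \<noteq> fps_of_poly h"
proof
  assume eq: "hilbert_series K P = fps_of_poly h"
  have P: "finite P" "\<forall>C\<in>P. is_cell C" "P \<noteq> {}"
    using assms unfolding collection_of_cells_def by auto
  obtain C where C: "C \<in> P" using P(3) by blast
  obtain x y where xy: "cell x y \<in> P" using P(2) C unfolding is_cell_iff by metis
  have "(x, y) \<in> vertices P" unfolding vertices_def by (rule UnionI[OF xy]) (simp add: mem_cell)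
  then have "class_count (vertices P) (rect_moves P) (Suc (degree h)) > 0"
    by (rule class_count_pos[OF finite_vertices[OF P(1,2)]])
  moreover have "hilbert_series K P $ Suc (degree h) = 0" unfolding eq by (simp add: coeff_eq_0)
  ultimately show False
    unfolding hilbert_series_eq_class_series[OF P(1,2)] class_series_def by simp
qed

theorem theorem2p2:
  fixes P :: "pt set set" and h :: "pt set set \<Rightarrow> int poly"
  assumes "collection_of_cells P" and "simple P"
    and "\<forall>Q\<in>components P. is_h_polynomial TYPE('k::field) Q (h Q)"
  shows "is_h_polynomial TYPE('k) P (\<Prod>Q\<in>components P. h Q)"
proof -
  have P: "finite P" "\<forall>C\<in>P. is_cell C" "P \<noteq> {}" "weakly_connected P"
    using assms(1) unfolding collection_of_cells_def by auto
  interpret simple_collection P by (rule simple_collection.intro[OF P(1,2) assms(2)])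
  let ?H = "hilbert_series TYPE('k)"
  have coll: "collection_of_cells Q" if "Q \<in> components P" for Q
    using component_polyomino[OF that] unfolding polyomino_def by blast
  have H: "?H Q = series Q" if "collection_of_cells Q" for Q
    using that hilbert_series_eq_class_series unfolding collection_of_cells_def by blast
  have "\<exists>e. ?H Q * (1 - fps_X) ^ Suc e = fps_of_poly (h Q)" if Q: "Q \<in> components P" for Q
  proof -
    obtain d where d: "?H Q * (1 - fps_X) ^ d = fps_of_poly (h Q)"
      using assms(3) Q unfolding is_h_polynomial_def by blast
    \<comment> \<open>\<open>K[Q]\<close> is infinite dimensional, so that its Krull dimension \<open>d\<close> is positive.\<close>
    then have "d \<noteq> 0"
      using hilbert_series_not_polynomial[OF coll[OF Q]] by (metis mult_1_right power_0)
    then show ?thesis using d not0_implies_Suc by blast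
  qed
  then obtain e where e: "\<And>Q. Q \<in> components P \<Longrightarrow>
      ?H Q * (1 - fps_X) ^ Suc (e Q) = fps_of_poly (h Q)" by metis
  \<comment> \<open>\<open>series_product\<close> consumes one factor \<open>1 - fps_X\<close> of
    each component and one of \<open>P\<close>; the remaining exponents \<open>e Q\<close> add
    up.\<close>
  let ?d = "Suc (\<Sum>Q\<in>components P. e Q)"
  have "?H P * (1 - fps_X) ^ ?d = ?H P * (1 - fps_X) * (\<Prod>Q\<in>components P. (1 - fps_X) ^ e Q)"
    by (simp add: power_sum mult_ac)
  also have "\<dots> = (\<Prod>Q\<in>components P. ?H Q * (1 - fps_X) ^ Suc (e Q))"
    using series_product[OF P(4,3)] H[OF assms(1)] H[OF coll]
    by (simp add: prod.distrib[symmetric] mult_ac)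
  also have "\<dots> = fps_of_poly (\<Prod>Q\<in>components P. h Q)"
    using e by (simp add: fps_of_poly_prod)
  finally have "?H P * (1 - fps_X) ^ ?d = fps_of_poly (\<Prod>Q\<in>components P. h Q)" .
  moreover have "poly (\<Prod>Q\<in>components P. h Q) 1 \<noteq> 0"
    using assms(3) finite_components unfolding is_h_polynomial_def by (simp add: poly_prod)
  ultimately show ?thesis unfolding is_h_polynomial_def by blast
qed

end
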